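(* Let $(\mathcal{E},\mathcal{F})$ be the self-similar form with parameter $s_0=\frac12$ on the tree-like fractal $K$, and let $R$ be its resistance metric. Then, whatever the self-similar reference measure $\mu=\mu_{\mathbf w}$ on $K$ with weights $w_0=w_1$, $w_2=w_3$, the strong elliptic Harnack inequality $(\mathrm{EHI})$ fails for $(K,R,\mu,\mathcal{E},\mathcal{F})$.
   Context: Fractal. Let $F_0,F_1,F_2,F_3:\mathbb{R}^2\to\mathbb{R}^2$ be $F_0(x,y)=\left(\frac29x+\frac{8}{9\sqrt3}y,\frac23y\right)$, $F_1(x,y)=\left(\frac29x-\frac{8}{9\sqrt3}y,\frac23y\right)$, $F_2(x,y)=\left(\frac13x-\frac23,\frac13y-\frac1{\sqrt3}\right)$, $F_3(x,y)=\left(\frac13x+\frac23,\frac13y-\frac1{\sqrt3}\right)$, and let $K$ be the unique non-empty compact set with $K=\bigcup_{i=0}^3F_i(K)$. For a finite word $\omega=i_1\cdots i_n\in\{0,1,2,3\}^n$ put $F_\omega=F_{i_1}\circ\cdots\circ F_{i_n}$ ($F_\emptyset=\mathrm{id}$). Let $q_1=(0,0)$ (fixed by $F_0$ and $F_1$), $q_2=(-1,-\frac{\sqrt3}{2})$ (fixed by $F_2$), $q_3=(1,-\frac{\sqrt3}{2})$ (fixed by $F_3$), $V_0=\{q_1,q_2,q_3\}$, $V_{n+1}=\bigcup_{i=0}^3F_i(V_n)$. Measure. For $\mathbf w=(w_0,w_1,w_2,w_3)\in(0,1)^4$ with $\sum_iw_i=1$, $\mu_{\mathbf w}$ is the unique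 Borel probability measure on $K$ with $\mu_{\mathbf w}(A)=\sum_{i=0}^3w_i\,\mu_{\mathbf w}(F_i^{-1}(A))$ for all Borel $A\subset K$. Form. Take $s_0=s_1=s_2=s_3=\frac12$, $s_\omega=s_{i_1}\cdots s_{i_n}$. For $u:V_0\to\mathbb{R}$ let $E_0(u)=(u(q_1)-u(q_2))^2+(u(q_1)-u(q_3))^2$, and for $u:V_n\to\mathbb{R}$ let $E_n(u)=\sum_{\omega\in\{0,1,2,3\}^n}s_\omega^{-1}E_0(u\circ F_\omega)$. For $u\in C(K)$ let $\mathcal{E}(u)=\lim_{n\to\infty}E_n(u|_{V_n})\in[0,\infty]$ (a non-decreasing limit), $\mathcal{F}=\{u\in C(K):\mathcal{E}(u)<\infty\}$, and let $\mathcal{E}(u,v)$ be the bilinear form on $\mathcal{F}$ obtained by polarization. $(\mathcal{E},\mathcal{F})$ is a regular Dirichlet form on $L^2(K,\mu)$ for each self-similar measure $\mu$. The resistance metric is $R(x,y)=1/\inf\{\mathcal{E}(u):u\in\mathcal{F},\,u(x)=0,\,u(y)=1\}$ for $x\ne y$ and $R(x,x)=0$; it is a metric inducing the original topology of $K$. Balls are $B(x,r)=\{y\in K:R(x,y)<r\}$, and $\varepsilon B=B(x,\varepsilon r)$ for $B=B(x,r)$. Harmonicity. For open $U\subset K$, $\mathcal{F}(U)$ is the completion, with respect to the norm $(\mathcal{E}(u)+\|u\|_{L^2(\mu)}^2)^{1/2}$, of the set of functions in $\mathcal{F}$ supported in $U$. A function $u\in\mathcal{F}$ is harmonic in $U$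 if $\mathcal{E}(u,\varphi)=0$ for all $\varphi\in\mathcal{F}(U)$. A non-negative harmonic function on a ball $B$ is a $u\in\mathcal{F}$ that is harmonic in $B$ and non-negative in $B$. Condition $(\mathrm{EHI})$: there are constants $\varepsilon\in(0,1)$ and $C\ge1$ such that for every ball $B=B(x,r)$ and every non-negative harmonic function $u$ on $B$, $$\operatorname*{ess\,sup}_{\varepsilon B}u\le C\operatorname*{ess\,inf}_{\varepsilon B}u.$$ *)

theory Defs
  imports "HOL-Probability.Probability"
begin

type_synonym point = "real \<times> real"

section \<open>The fractal\<close>

definition fmap :: "nat \<Rightarrow> point \<Rightarrow> point" where
  "fmap i = (\<lambda>(x, y).
     if i = 0 then (2 / 9 * x + 8 / (9 * sqrt 3) * y, 2 / 3 * y)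
     else if i = 1 then (2 / 9 * x - 8 / (9 * sqrt 3) * y, 2 / 3 * y)
     else if i = 2 then (1 / 3 * x - 2 / 3, 1 / 3 * y - 1 / sqrt 3)
     else (1 / 3 * x + 2 / 3, 1 / 3 * y - 1 / sqrt 3))"

definition words :: "nat \<Rightarrow> nat list set" where
  "words n = {\<omega>. length \<omega> = n \<and> set \<omega> \<subseteq> {..<4}}"

primrec fword :: "nat list \<Rightarrow> point \<Rightarrow> point" where
  "fword [] = id"
| "fword (i # \<omega>) = fmap i \<circ> fword \<omega>"

definition invariant_compact :: "point set \<Rightarrow> bool" where
  "invariant_compact A \<longleftrightarrow> A \<noteq> {} \<and> compact A \<and> A = (\<Union>i<4. fmap i ` A)"

text \<open>Existence and uniqueness are proved in \<open>ex1_invariant_compact\<close> below.\<close>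

definition K :: "point set" where
  "K = (THE A. invariant_compact A)"

definition q\<^sub>1 :: point where "q\<^sub>1 = (0, 0)"
definition q\<^sub>2 :: point where "q\<^sub>2 = (- 1, - (sqrt 3 / 2))"
definition q\<^sub>3 :: point where "q\<^sub>3 = (1, - (sqrt 3 / 2))"

lemma fmap_contraction: "dist (fmap i p) (fmap i q) \<le> 9 / 10 * dist p q"
proof -
  obtain x y x' y' where p: "p = (x, y)" and q: "q = (x', y')"
    by (cases p, cases q)
  define a b k where "a = x - x'" and "b = y - y'" and "k = 8 / (9 * sqrt 3)"
  have k2: "k\<^sup>2 = 64 / 243"
    by (simp add: k_def power_divide power_mult_distrib)
  have dist_fst_snd: "dist u v = sqrt ((fst u - fst v)\<^sup>2 + (snd u - snd v)\<^sup>2)" for u v :: point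
    by (simp add: dist_prod_def dist_real_def)
  have main: "(2 / 9 * a + l * b)\<^sup>2 + (2 / 3 * b)\<^sup>2 \<le> (9 / 10)\<^sup>2 * (a\<^sup>2 + b\<^sup>2)"
    if l: "l\<^sup>2 = 64 / 243" for l
  proof -
    have "(2 / 9 * a + l * b)\<^sup>2 \<le> ((2 / 9)\<^sup>2 + l\<^sup>2) * (a\<^sup>2 + b\<^sup>2)"
    proof -
      have "((2 / 9)\<^sup>2 + l\<^sup>2) * (a\<^sup>2 + b\<^sup>2) - (2 / 9 * a + l * b)\<^sup>2 = (2 / 9 * b - l * a)\<^sup>2"
        by (simp add: power2_eq_square algebra_simps)
      then show ?thesis
        using zero_le_power2[of "2 / 9 * b - l * a"] by linarith
    qed
    also have "\<dots> = 76 / 243 * (a\<^sup>2 + b\<^sup>2)"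
      unfolding l by (simp add: power_divide)
    finally have bound: "(2 / 9 * a + l * b)\<^sup>2 \<le> 76 / 243 * (a\<^sup>2 + b\<^sup>2)" .
    have eqs: "(2 / 3 * b)\<^sup>2 = 4 / 9 * b\<^sup>2" "(9 / 10 :: real)\<^sup>2 = 81 / 100"
      by (simp_all add: power_mult_distrib power_divide)
    have "X + 4 / 9 * v \<le> 81 / 100 * (u + v)"
      if "X \<le> 76 / 243 * (u + v)" "0 \<le> u" "0 \<le> v" for X u v :: real
      using that by (simp add: field_simps)
    from this[OF bound] show ?thesis
      unfolding eqs by simp
  qed
  have small: "(1 / 3 * a)\<^sup>2 + (1 / 3 * b)\<^sup>2 \<le> (9 / 10)\<^sup>2 * (a\<^sup>2 + b\<^sup>2)"
  proof -
    have "(1 / 3 * a)\<^sup>2 + (1 / 3 * b)\<^sup>2 = (1 / 3)\<^sup>2 * (a\<^sup>2 + b\<^sup>2)"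
      by (simp only: power_mult_distrib distrib_left)
    also have "\<dots> \<le> (9 / 10)\<^sup>2 * (a\<^sup>2 + b\<^sup>2)"
      by (intro mult_right_mono power_mono) auto
    finally show ?thesis .
  qed
  have mk: "(- k)\<^sup>2 = 64 / 243" using k2 by simp
  have "(fst (fmap i p) - fst (fmap i q))\<^sup>2 + (snd (fmap i p) - snd (fmap i q))\<^sup>2
      \<le> (9 / 10)\<^sup>2 * (a\<^sup>2 + b\<^sup>2)"
  proof -
    consider "i = 0" | "i = 1" | "i \<noteq> 0" "i \<noteq> 1" by blast
    then show ?thesis
    proof cases
      case 1
      have "fst (fmap i p) - fst (fmap i q) = 2 / 9 * a + k * b"
        "snd (fmap i p) - snd (fmap i q) = 2 / 3 * b"
        using 1 by (simp_all add: fmap_def p q a_def b_def k_def algebra_simps diff_divide_distrib)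
      then show ?thesis using main[OF k2] by (simp only:)
    next
      case 2
      have "fst (fmap i p) - fst (fmap i q) = 2 / 9 * a + (- k) * b"
        "snd (fmap i p) - snd (fmap i q) = 2 / 3 * b"
        using 2 by (simp_all add: fmap_def p q a_def b_def k_def algebra_simps diff_divide_distrib)
      then show ?thesis using main[OF mk] by (simp only:)
    next
      case 3
      have "fst (fmap i p) - fst (fmap i q) = 1 / 3 * a"
        "snd (fmap i p) - snd (fmap i q) = 1 / 3 * b"
        using 3 by (simp_all add: fmap_def p q a_def b_def algebra_simps diff_divide_distrib)
      then show ?thesis using small by (simp only:)
    qed
  qed
  then have "dist (fmap i p) (fmap i q) \<le> sqrt ((9 / 10)\<^sup>2 * (a\<^sup>2 + b\<^sup>2))"
    by (simp add: dist_fst_snd)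
  also have "\<dots> = 9 / 10 * dist p q"
    by (simp only: real_sqrt_mult dist_fst_snd) (simp add: p q a_def b_def)
  finally show ?thesis .
qed

lemma continuous_on_fmap: "continuous_on S (fmap i)"
proof (rule continuous_onI)
  fix x e assume "x \<in> S" "(0::real) < e"
  have "dist (fmap i x') (fmap i x) \<le> e" if "dist x' x < e" for x'
    using fmap_contraction[of i x' x] that zero_le_dist[of x' x] by linarith
  then show "\<exists>d>0. \<forall>x'\<in>S. dist x' x < d \<longrightarrow> dist (fmap i x') (fmap i x) \<le> e"
    using \<open>0 < e\<close> by blast
qed

lemma invariant_compact_subset:
  assumes "invariant_compact A" "invariant_compact B"
  shows "A \<subseteq> B"
proof -
  have A: "A \<noteq> {}" "compact A" "A = (\<Union>i<4. fmap i ` A)"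
    and B: "B \<noteq> {}" "compact B" "B = (\<Union>i<4. fmap i ` B)"
    using assms unfolding invariant_compact_def by blast+
  have "continuous_on A (\<lambda>y. infdist y B)"
    by (intro continuous_on_infdist continuous_on_id)
  from continuous_attains_sup[OF A(2,1) this]
  obtain x where x: "x \<in> A" and x_max: "\<And>y. y \<in> A \<Longrightarrow> infdist y B \<le> infdist x B"
    by blast
  obtain i k where ik: "i < 4" "k \<in> A" "x = fmap i k" using x A(3) by blast
  obtain y where y: "y \<in> B" "infdist k B = dist k y"
    using infdist_attains_inf[of B k] B compact_imp_closed by blast
  have "fmap i y \<in> B" using y(1) ik(1) B(3) by blast
  then have "infdist x B \<le> dist x (fmap i y)" by (rule infdist_le)
  also have "\<dots> \<le> 9 / 10 * infdist k B"
    using fmap_contraction[of i k y] ik(3) y(2) by simp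
  also have "\<dots> \<le> 9 / 10 * infdist x B" using x_max[OF ik(2)] by simp
  finally have "infdist x B \<le> 0" by simp
  then have "infdist y B = 0" if "y \<in> A" for y
    using x_max[OF that] infdist_nonneg[of y B] by linarith
  then show ?thesis
    using in_closed_iff_infdist_zero[of B] B compact_imp_closed by blast
qed

lemma fword_bounded:
  assumes "\<And>i. fmap i 0 \<in> cball 0 1"
  shows "set \<omega> \<subseteq> {..<4} \<Longrightarrow> norm (fword \<omega> q\<^sub>1) \<le> 10"
proof (induction \<omega>)
  case Nil then show ?case by (simp add: q\<^sub>1_def)
next
  case (Cons i \<omega>)
  have "norm (fmap i (fword \<omega> q\<^sub>1)) \<le> dist (fmap i (fword \<omega> q\<^sub>1)) (fmap i 0) + norm (fmap i 0)"
    using norm_triangle_sub[of "fmap i (fword \<omega> q\<^sub>1)" "fmap i 0"] by (simp add: dist_norm)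
  also have "\<dots> \<le> 9 / 10 * 10 + 1"
    using fmap_contraction[of i "fword \<omega> q\<^sub>1" 0] Cons assms[of i] by simp
  finally show ?case by simp
qed

lemma ex1_invariant_compact: "\<exists>!A. invariant_compact A"
proof (rule ex_ex1I)
  define S where "S = {fword \<omega> q\<^sub>1 | \<omega>. set \<omega> \<subseteq> {..<4}}"
  have fm0: "fmap i 0 \<in> cball 0 1" for i
    by (simp add: fmap_def zero_prod_def dist_prod_def dist_real_def power_divide)
  have "bounded S"
    unfolding bounded_iff S_def using fword_bounded[OF fm0] by blast
  then have comp: "compact (closure S)" by (simp add: compact_closure)
  have "q\<^sub>1 = fmap 0 q\<^sub>1" by (simp add: fmap_def q\<^sub>1_def)
  have S: "S = (\<Union>i<4. fmap i ` S)"
  proof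
    show "S \<subseteq> (\<Union>i<4. fmap i ` S)"
    proof
      fix x assume "x \<in> S"
      then obtain \<omega> where \<omega>: "x = fword \<omega> q\<^sub>1" "set \<omega> \<subseteq> {..<4}" by (auto simp: S_def)
      show "x \<in> (\<Union>i<4. fmap i ` S)"
      proof (cases \<omega>)
        case Nil
        then have "x = fmap 0 (fword [] q\<^sub>1)" using \<omega> \<open>q\<^sub>1 = fmap 0 q\<^sub>1\<close> by simp
        moreover have "fword [] q\<^sub>1 \<in> S" unfolding S_def by (intro CollectI exI[of _ "[]"]) simp
        ultimately show ?thesis by (auto intro!: bexI[of _ 0])
      next
        case (Cons i \<nu>)
        then have "x = fmap i (fword \<nu> q\<^sub>1)" "fword \<nu> q\<^sub>1 \<in> S" "i < 4"
          using \<omega> by (auto simp: S_def)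
        then show ?thesis by blast
      qed
    qed
    show "(\<Union>i<4. fmap i ` S) \<subseteq> S"
    proof (intro UN_least image_subsetI)
      fix i :: nat and x assume "i \<in> {..<4}" "x \<in> S"
      then have "i < 4" by simp
      from \<open>x \<in> S\<close> obtain \<omega> where "x = fword \<omega> q\<^sub>1" "set \<omega> \<subseteq> {..<4}" by (auto simp: S_def)
      then have "fmap i x = fword (i # \<omega>) q\<^sub>1" "set (i # \<omega>) \<subseteq> {..<4}"
        using \<open>i < 4\<close> by auto
      then show "fmap i x \<in> S" unfolding S_def by blast
    qed
  qed
  have im: "fmap i ` closure S = closure (fmap i ` S)" for i
  proof
    show "fmap i ` closure S \<subseteq> closure (fmap i ` S)"
      by (rule image_closure_subset[OF continuous_on_fmap]) (auto intro: closure_subset[THEN subsetD])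
    show "closure (fmap i ` S) \<subseteq> fmap i ` closure S"
      by (rule closure_minimal)
        (auto intro: closure_subset[THEN subsetD] compact_imp_closed
          compact_continuous_image[OF continuous_on_fmap comp])
  qed
  have "closure S = (\<Union>i<4. fmap i ` closure S)"
    unfolding im by (subst S) (simp add: eval_nat_numeral lessThan_Suc)
  moreover have "closure S \<noteq> {}"
  proof -
    have "fword [] q\<^sub>1 \<in> S" unfolding S_def by (intro CollectI exI[of _ "[]"]) simp
    then show ?thesis using closure_subset by blast
  qed
  ultimately have "invariant_compact (closure S)"
    using comp unfolding invariant_compact_def by blast
  then show "\<exists>A. invariant_compact A" ..
next
  show "A = B" if "invariant_compact A" "invariant_compact B" for A B
    using invariant_compact_subset that by blast
qed

lemma invariant_compact_K: "invariant_compact K"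
  unfolding K_def using ex1_invariant_compact by (rule theI')


section \<open>Self-similar measures\<close>

definition self_similar_measure :: "(nat \<Rightarrow> real) \<Rightarrow> point measure \<Rightarrow> bool" where
  "self_similar_measure w \<mu> \<longleftrightarrow>
     sets \<mu> = sets (restrict_space borel K) \<and> prob_space \<mu> \<and>
     (\<forall>A\<in>sets \<mu>. measure \<mu> A = (\<Sum>i<4. w i * measure \<mu> (fmap i -` A \<inter> K)))"


section \<open>The form\<close>

text \<open>
  Functions on \<open>K\<close> or \<open>V_n\<close> are total functions on the plane of which only the values on
  \<open>K\<close> matter; since \<open>fword \<omega>\<close> for \<open>\<omega> \<in> words n\<close> maps \<open>{q\<^sub>1, q\<^sub>2, q\<^sub>3}\<close> into
  \<open>V_n\<close>, \<open>form_n n u\<close> only sees the restriction of \<open>u\<close> to \<open>V_n\<close>.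
\<close>

definition scale :: "nat \<Rightarrow> real" where
  "scale i = 1 / 2"

definition scale_word :: "nat list \<Rightarrow> real" where
  "scale_word \<omega> = prod_list (map scale \<omega>)"

definition form_0 :: "(point \<Rightarrow> real) \<Rightarrow> real" where
  "form_0 u = (u q\<^sub>1 - u q\<^sub>2)\<^sup>2 + (u q\<^sub>1 - u q\<^sub>3)\<^sup>2"

definition form_n :: "nat \<Rightarrow> (point \<Rightarrow> real) \<Rightarrow> real" where
  "form_n n u = (\<Sum>\<omega>\<in>words n. inverse (scale_word \<omega>) * form_0 (u \<circ> fword \<omega>))"

definition energy :: "(point \<Rightarrow> real) \<Rightarrow> ereal" where
  "energy u = lim (\<lambda>n. ereal (form_n n u))"

definition form_domain :: "(point \<Rightarrow> real) set" where
  "form_domain = {u. continuous_on K u \<and> energy u < \<infinity>}"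

definition form :: "(point \<Rightarrow> real) \<Rightarrow> (point \<Rightarrow> real) \<Rightarrow> real" where
  "form u v = (real_of_ereal (energy (\<lambda>x. u x + v x)) - real_of_ereal (energy (\<lambda>x. u x - v x))) / 4"


section \<open>Resistance metric\<close>

definition resistance :: "point \<Rightarrow> point \<Rightarrow> real" where
  "resistance x y =
     (if x = y then 0
      else 1 / Inf {real_of_ereal (energy u) | u. u \<in> form_domain \<and> u x = 0 \<and> u y = 1})"

definition rball :: "point \<Rightarrow> real \<Rightarrow> point set" where
  "rball x r = {y \<in> K. resistance x y < r}"


section \<open>Harmonic functions and the Harnack inequality\<close>

definition supp :: "(point \<Rightarrow> real) \<Rightarrow> point set" where
  "supp u = closure {x \<in> K. u x \<noteq> 0}"

definition form_norm :: "point measure \<Rightarrow> (point \<Rightarrow> real) \<Rightarrow> real" where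
  "form_norm \<mu> u = sqrt (real_of_ereal (energy u) + (\<integral>x. (u x)\<^sup>2 \<partial>\<mu>))"

text \<open>
  The form domain is complete for \<open>form_norm \<mu>\<close> (the form is closed), so the completion of a
  subspace is its closure in the form domain.
\<close>

definition form_domain_on :: "point measure \<Rightarrow> point set \<Rightarrow> (point \<Rightarrow> real) set" where
  "form_domain_on \<mu> U =
     {\<phi> \<in> form_domain. \<exists>\<psi> :: nat \<Rightarrow> point \<Rightarrow> real.
        (\<forall>n. \<psi> n \<in> form_domain \<and> supp (\<psi> n) \<subseteq> U) \<and>
        (\<lambda>n. form_norm \<mu> (\<lambda>x. \<phi> x - \<psi> n x)) \<longlonglongrightarrow> 0}"

definition harmonic_in :: "point measure \<Rightarrow> point set \<Rightarrow> (point \<Rightarrow> real) \<Rightarrow> bool" where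
  "harmonic_in \<mu> U u \<longleftrightarrow> u \<in> form_domain \<and> (\<forall>\<phi>\<in>form_domain_on \<mu> U. form u \<phi> = 0)"

definition nonneg_harmonic_in :: "point measure \<Rightarrow> point set \<Rightarrow> (point \<Rightarrow> real) \<Rightarrow> bool" where
  "nonneg_harmonic_in \<mu> B u \<longleftrightarrow> harmonic_in \<mu> B u \<and> (\<forall>x\<in>B. 0 \<le> u x)"

definition esssup_on :: "point measure \<Rightarrow> point set \<Rightarrow> (point \<Rightarrow> real) \<Rightarrow> ereal" where
  "esssup_on \<mu> A u = esssup (restrict_space \<mu> A) (\<lambda>x. ereal (u x))"

definition essinf_on :: "point measure \<Rightarrow> point set \<Rightarrow> (point \<Rightarrow> real) \<Rightarrow> ereal" where
  "essinf_on \<mu> A u = - esssup_on \<mu> A (\<lambda>x. - u x)"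

definition EHI :: "point measure \<Rightarrow> bool" where
  "EHI \<mu> \<longleftrightarrow>
     (\<exists>\<epsilon> C :: real. 0 < \<epsilon> \<and> \<epsilon> < 1 \<and> 1 \<le> C \<and>
       (\<forall>x\<in>K. \<forall>r>0. \<forall>u. nonneg_harmonic_in \<mu> (rball x r) u \<longrightarrow>
          esssup_on \<mu> (rball x (\<epsilon> * r)) u \<le> ereal C * essinf_on \<mu> (rball x (\<epsilon> * r)) u))"

end

theory Submission
  imports Defs
begin

text \<open>
  The Harnack inequality fails because the tree branches without bound at the vertex \<open>q\<^sub>1\<close>.
  Both maps \<open>F\<^sub>0\<close> and \<open>F\<^sub>1\<close> fix \<open>q\<^sub>1\<close>, so \<open>q\<^sub>1\<close> is the apex of \<open>2\<^sup>n\<close> cells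
  \<open>F\<^sub>\<omega>(K)\<close> with \<open>\<omega> \<in> {0,1}\<^sup>n\<close>. In each of them a leg of resistance \<open>2\<^sup>-\<^sup>n\<close> leads from \<open>q\<^sub>1\<close> to
  the end \<open>F\<^sub>\<omega>(q\<^sub>2)\<close>. Harmonicity at \<open>q\<^sub>1\<close> is Kirchhoff's law: the slopes add up to zero. So a
  harmonic function may decrease along \<open>2\<^sup>n - 1\<close> of these legs, linearly from the value 1 at \<open>q\<^sub>1\<close>
  to the value 0 at the end, and compensate this by increasing \<open>2\<^sup>n - 1\<close> times as fast along the
  remaining one, while it is constant on what branches off from the legs and on the legs to
  \<open>F\<^sub>\<omega>(q\<^sub>3)\<close>. This function, called \<open>steep n\<close> below, is non-negative and harmonic in
  \<open>B(q\<^sub>1, 2\<^sup>-\<^sup>n)\<close>. At relative distance \<open>\<epsilon>\<close> from \<open>q\<^sub>1\<close> it exceeds a multiple of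
  \<open>\<epsilon> 2\<^sup>n\<close> on the steep leg and is at most 1 on the others, and no constant bounds this ratio for all \<open>n\<close>.

  The building block is the function \<open>leg\<close> on \<open>K\<close>, which is linear from 0 to 1 along the geodesic
  from \<open>q\<^sub>1\<close> to \<open>q\<^sub>2\<close> and constant on everything that branches off. It is the fixed point of a
  gluing operator, and the key fact \<open>bform_leg\<close> says that its form with any \<open>v\<close> is
  \<open>v(q\<^sub>2) - v(q\<^sub>1)\<close> at every level. Copies of it in the cells around \<open>q\<^sub>1\<close> give \<open>steep n\<close>, whose form with
  \<open>v\<close> vanishes at every level from \<open>n\<close> on once \<open>v\<close> vanishes at the ends \<open>F\<^sub>\<omega>(q\<^sub>2)\<close> (\<open>bform_steep\<close>).
  This passes to the completion by a quadratic-form argument (\<open>bform_zero_completion\<close>).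

  Two bounds on the resistance to \<open>q\<^sub>1\<close> are needed. The ends are at distance at least \<open>2\<^sup>-\<^sup>n\<close>, by a
  test function of energy \<open>2\<^sup>n\<close> that lives in one cell (\<open>resistance_root_word\<close>); hence they lie
  outside the ball. A cell of level \<open>m\<close> at \<open>q\<^sub>1\<close> has points at distance at most \<open>9 \<cdot> 2\<^sup>-\<^sup>m\<close>
  (\<open>resistance_root_cell\<close>), so the small ball contains whole cells, on which every self-similar measure
  is positive (\<open>cell_measure_pos\<close>). The essential bounds therefore see both the large and the small
  values of \<open>steep n\<close>.
\<close>

section \<open>Geometry of the fractal\<close>

lemma compact_K: "compact K" and K_nonempty: "K \<noteq> {}" and K_eq: "K = (\<Union>i<4. fmap i ` K)"
  using invariant_compact_K unfolding invariant_compact_def by blast+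

lemma closed_K: "closed K"
  by (rule compact_imp_closed[OF compact_K])

lemma fmap_in_K: "i < 4 \<Longrightarrow> x \<in> K \<Longrightarrow> fmap i x \<in> K"
  using K_eq by blast

lemma K_cases:
  assumes "x \<in> K"
  obtains i y where "i < 4" "y \<in> K" "x = fmap i y"
  using assms K_eq by blast

text \<open>
  The point of \<open>K\<close> farthest from \<open>B\<close> is itself the image of a point of \<open>K\<close>, and the contraction
  brings images closer to \<open>B\<close>; so the largest distance is zero. Inequalities that propagate
  through the maps are proved on \<open>K\<close> by this principle.
\<close>

lemma K_subset_closed_invariant:
  assumes "closed B" "B \<noteq> {}" and inv: "\<And>i y. i < 4 \<Longrightarrow> y \<in> B \<Longrightarrow> fmap i y \<in> B"
  shows "K \<subseteq> B"
proof -
  have "continuous_on K (\<lambda>y. infdist y B)"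
    by (intro continuous_on_infdist continuous_on_id)
  from continuous_attains_sup[OF compact_K K_nonempty this]
  obtain x where x: "x \<in> K" and x_max: "\<And>y. y \<in> K \<Longrightarrow> infdist y B \<le> infdist x B"
    by blast
  obtain i k where ik: "i < 4" "k \<in> K" "x = fmap i k" using x by (rule K_cases)
  obtain y where y: "y \<in> B" "infdist k B = dist k y"
    using infdist_attains_inf[of B k] assms by blast
  have "infdist x B \<le> dist x (fmap i y)" by (rule infdist_le[OF inv[OF ik(1) y(1)]])
  also have "\<dots> \<le> 9 / 10 * infdist k B"
    using fmap_contraction[of i k y] ik(3) y(2) by simp
  also have "\<dots> \<le> 9 / 10 * infdist x B" using x_max[OF ik(2)] by simp
  finally have "infdist x B \<le> 0" by simp
  then have "infdist y B = 0" if "y \<in> K" for y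
    using x_max[OF that] infdist_nonneg[of y B] by linarith
  then show ?thesis
    using in_closed_iff_infdist_zero[of B] assms by blast
qed

lemma fixed_point_in_K:
  assumes "i < 4" "fmap i p = p"
  shows "p \<in> K"
proof -
  obtain y where y: "y \<in> K" "infdist p K = dist p y"
    using infdist_attains_inf[of K p] closed_K K_nonempty by blast
  have "infdist p K \<le> dist p (fmap i y)" by (rule infdist_le[OF fmap_in_K[OF assms(1) y(1)]])
  also have "\<dots> \<le> 9 / 10 * infdist p K"
    using fmap_contraction[of i p y] assms(2) y(2) by simp
  finally have "infdist p K = 0" using infdist_nonneg[of p K] by linarith
  then show ?thesis using in_closed_iff_infdist_zero[OF closed_K K_nonempty] by blast
qed

lemma sqrt3_facts: "sqrt 3 * sqrt 3 = (3::real)" "1 / sqrt 3 = sqrt 3 / (3::real)"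
  "8 / (9 * sqrt 3) = 8 * sqrt 3 / (27::real)" "0 < sqrt (3::real)"
  by (simp_all add: field_simps)

text \<open>
  Every occurrence of the square root of 3 is moved next to \<open>y\<close>, so that conditions on \<open>x\<close> and
  \<open>sqrt 3 * y\<close> are linear with rational coefficients.
\<close>

lemma fmap_apply:
  "fmap 0 (x, y) = (2 / 9 * x + 8 / 27 * (sqrt 3 * y), 2 / 3 * y)"
  "fmap (Suc 0) (x, y) = (2 / 9 * x - 8 / 27 * (sqrt 3 * y), 2 / 3 * y)"
  "fmap 2 (x, y) = (1 / 3 * x - 2 / 3, 1 / 3 * y - sqrt 3 / 3)"
  "fmap 3 (x, y) = (1 / 3 * x + 2 / 3, 1 / 3 * y - sqrt 3 / 3)"
  by (simp_all add: fmap_def sqrt3_facts)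

lemma fmap_q:
  "fmap 0 q\<^sub>1 = q\<^sub>1" "fmap (Suc 0) q\<^sub>1 = q\<^sub>1" "fmap 2 q\<^sub>2 = q\<^sub>2" "fmap 3 q\<^sub>3 = q\<^sub>3"
  "fmap 2 q\<^sub>1 = fmap 0 q\<^sub>2" "fmap 3 q\<^sub>1 = fmap (Suc 0) q\<^sub>3"
  by (simp_all add: fmap_apply q\<^sub>1_def q\<^sub>2_def q\<^sub>3_def sqrt3_facts)

lemma q_in_K: "q\<^sub>1 \<in> K" "q\<^sub>2 \<in> K" "q\<^sub>3 \<in> K"
  using fixed_point_in_K[of 0] fixed_point_in_K[of 2] fixed_point_in_K[of 3] by (simp_all add: fmap_q)

lemma less_4_cases: "i < 4 \<longleftrightarrow> i = 0 \<or> i = Suc 0 \<or> i = 2 \<or> i = (3::nat)"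
  by auto

lemma K_in_triangle:
  assumes "(x, y) \<in> K"
  shows "3 * x \<le> - 2 * (sqrt 3 * y)" "- 3 * x \<le> - 2 * (sqrt 3 * y)" "- 3 / 2 \<le> sqrt 3 * y"
proof -
  define T :: "point set" where "T = {p. 3 * fst p \<le> - 2 * (sqrt 3 * snd p) \<and>
    - 3 * fst p \<le> - 2 * (sqrt 3 * snd p) \<and> - 3 / 2 \<le> sqrt 3 * snd p}"
  have "closed T"
    unfolding T_def by (intro closed_Collect_conj closed_Collect_le continuous_intros)
  moreover have "q\<^sub>1 \<in> T" by (simp add: T_def q\<^sub>1_def)
  moreover have "fmap i p \<in> T" if "i < 4" "p \<in> T" for i p
  proof -
    obtain x y where p: "p = (x, y)" by (cases p)
    have s: "sqrt 3 * (1 / 3 * y - sqrt 3 / 3) = 1 / 3 * (sqrt 3 * y) - 1"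
      "sqrt 3 * (2 / 3 * y) = 2 / 3 * (sqrt 3 * y)"
      using sqrt3_facts(1) by (simp_all add: algebra_simps)
    have h: "3 * x \<le> - 2 * (sqrt 3 * y)" "- 3 * x \<le> - 2 * (sqrt 3 * y)" "- 3 / 2 \<le> sqrt 3 * y"
      using \<open>p \<in> T\<close> by (simp_all add: T_def p)
    from \<open>i < 4\<close> consider "i = 0" | "i = Suc 0" | "i = 2" | "i = 3" by (auto simp: less_4_cases)
    then show ?thesis
      unfolding T_def p mem_Collect_eq
      by cases (simp_all only: fmap_apply fst_conv snd_conv s, simp_all only: distrib_left right_diff_distrib, (intro conjI; use h in linarith)+)
  qed
  ultimately have "K \<subseteq> T" using K_subset_closed_invariant by blast
  then show "3 * x \<le> - 2 * (sqrt 3 * y)" "- 3 * x \<le> - 2 * (sqrt 3 * y)" "- 3 / 2 \<le> sqrt 3 * y"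
    using assms unfolding T_def by auto
qed

lemma fmap_inj: "i < 4 \<Longrightarrow> fmap i p = fmap i q \<Longrightarrow> p = q"
  by (cases p; cases q) (auto simp: less_4_cases fmap_apply)

text \<open>
  The cells meet in three points only. Cells 0 and 1 lie in the two half planes bounded by the
  vertical axis and touch it at their apex alone. Cells 2 and 3 lie below the line
  \<open>sqrt 3 * y = - 1\<close>, which bounds cells 0 and 1 from below, and reach it at their apex alone. The
  remaining pairs are separated by the vertical axis.
\<close>

lemma fmap_coincidence:
  assumes "p \<in> K" "q \<in> K"
  shows "fmap 0 p = fmap (Suc 0) q \<Longrightarrow> p = q\<^sub>1 \<and> q = q\<^sub>1"
    and "fmap 0 p = fmap 2 q \<Longrightarrow> p = q\<^sub>2 \<and> q = q\<^sub>1"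
    and "fmap 0 p \<noteq> fmap 3 q"
    and "fmap (Suc 0) p \<noteq> fmap 2 q"
    and "fmap (Suc 0) p = fmap 3 q \<Longrightarrow> p = q\<^sub>3 \<and> q = q\<^sub>1"
    and "fmap 2 p \<noteq> fmap 3 q"
proof -
  obtain x y where p: "p = (x, y)" by (cases p)
  obtain x' y' where q: "q = (x', y')" by (cases q)
  define Y Y' where "Y = sqrt 3 * y" and "Y' = sqrt 3 * y'"
  have P: "3 * x \<le> - 2 * Y" "- 3 * x \<le> - 2 * Y" "- 3 / 2 \<le> Y"
    and Q: "3 * x' \<le> - 2 * Y'" "- 3 * x' \<le> - 2 * Y'" "- 3 / 2 \<le> Y'"
    using K_in_triangle assms unfolding p q Y_def Y'_def by blast+
  have y: "y = Y / sqrt 3" "y' = Y' / sqrt 3" by (simp_all add: Y_def Y'_def)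
  have s2: "sqrt 3 * (2 / 3 * y) = 2 / 3 * Y" "sqrt 3 * (2 / 3 * y') = 2 / 3 * Y'"
    and s3: "sqrt 3 * (1 / 3 * y' - sqrt 3 / 3) = 1 / 3 * Y' - 1"
    using sqrt3_facts(1) by (simp_all add: algebra_simps Y_def Y'_def)
  have root: "q = q\<^sub>1" if "Y' = 0"
  proof -
    have "x' = 0" using Q that by linarith
    then show ?thesis using that by (simp add: q q\<^sub>1_def y)
  qed
  {
    assume "fmap 0 p = fmap (Suc 0) q"
    then have e: "2 / 9 * x + 8 / 27 * Y = 2 / 9 * x' - 8 / 27 * Y'" "2 / 3 * y = 2 / 3 * y'"
      by (simp_all only: fmap_apply p q Y_def Y'_def prod.inject)
    have "Y = Y'" using e(2) by (simp add: Y_def Y'_def)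
    then have z: "Y = 0" "Y' = 0" using e(1) P Q by linarith+
    then have "x = 0" "x' = 0" using P Q by linarith+
    then show "p = q\<^sub>1 \<and> q = q\<^sub>1" using z by (simp add: p q q\<^sub>1_def y)
  next
    assume e: "fmap 0 p = fmap 2 q"
    then have "sqrt 3 * (2 / 3 * y) = sqrt 3 * (1 / 3 * y' - sqrt 3 / 3)"
      by (simp add: fmap_apply p q)
    then have "2 / 3 * Y = 1 / 3 * Y' - 1" unfolding s2 s3 .
    then have "Y' = 0" using P Q by linarith
    then have "q = q\<^sub>1" by (rule root)
    then show "p = q\<^sub>2 \<and> q = q\<^sub>1" using e fmap_inj[of 0 p q\<^sub>2] by (simp add: fmap_q)
  next
    assume e: "fmap (Suc 0) p = fmap 3 q"
    then have "sqrt 3 * (2 / 3 * y) = sqrt 3 * (1 / 3 * y' - sqrt 3 / 3)"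
      by (simp add: fmap_apply p q)
    then have "2 / 3 * Y = 1 / 3 * Y' - 1" unfolding s2 s3 .
    then have "Y' = 0" using P Q by linarith
    then have "q = q\<^sub>1" by (rule root)
    then show "p = q\<^sub>3 \<and> q = q\<^sub>1" using e fmap_inj[of "Suc 0" p q\<^sub>3] by (simp add: fmap_q)
  next
    show "fmap 0 p \<noteq> fmap 3 q"
    proof
      assume "fmap 0 p = fmap 3 q"
      then have "2 / 9 * x + 8 / 27 * Y = 1 / 3 * x' + 2 / 3" by (simp add: fmap_apply p q Y_def)
      then show False using P Q by linarith
    qed
    show "fmap (Suc 0) p \<noteq> fmap 2 q"
    proof
      assume "fmap (Suc 0) p = fmap 2 q"
      then have "2 / 9 * x - 8 / 27 * Y = 1 / 3 * x' - 2 / 3" by (simp add: fmap_apply p q Y_def)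
      then show False using P Q by linarith
    qed
    show "fmap 2 p \<noteq> fmap 3 q"
    proof
      assume "fmap 2 p = fmap 3 q"
      then have "1 / 3 * x - 2 / 3 = 1 / 3 * x' + 2 / 3" by (simp add: fmap_apply p q)
      then show False using P Q by linarith
    qed
  }
qed

section \<open>Gluing functions along the cells\<close>

text \<open>
  These are exactly the equations at the three points where cells meet.
\<close>

definition compatible :: "(nat \<Rightarrow> point \<Rightarrow> real) \<Rightarrow> bool" where
  "compatible f \<longleftrightarrow> f 0 q\<^sub>1 = f (Suc 0) q\<^sub>1 \<and> f 0 q\<^sub>2 = f 2 q\<^sub>1 \<and> f (Suc 0) q\<^sub>3 = f 3 q\<^sub>1"

text \<open>
  The choice is unambiguous on \<open>K\<close> precisely for compatible families.
\<close>

definition glue :: "(nat \<Rightarrow> point \<Rightarrow> real) \<Rightarrow> point \<Rightarrow> real" where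
  "glue f p = (SOME t. \<exists>i<4. \<exists>x\<in>K. p = fmap i x \<and> t = f i x)"

lemma compatible_eq:
  assumes "compatible f" "i < 4" "j < 4" "p \<in> K" "q \<in> K" "fmap i p = fmap j q"
  shows "f i p = f j q"
proof (cases "i = j")
  case True
  then have "p = q" using fmap_inj[OF assms(2)] assms(6) by simp
  then show ?thesis using True by simp
next
  case False
  have comp: "f 0 q\<^sub>1 = f (Suc 0) q\<^sub>1" "f 0 q\<^sub>2 = f 2 q\<^sub>1" "f (Suc 0) q\<^sub>3 = f 3 q\<^sub>1"
    using assms(1) by (simp_all add: compatible_def)
  have ordered: "f k x = f l y" if "k < l" "l < 4" "x \<in> K" "y \<in> K" "fmap k x = fmap l y" for k l x y
  proof -
    from that(1,2) consider "k = 0" "l = Suc 0" | "k = 0" "l = 2" | "k = 0" "l = 3"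
      | "k = Suc 0" "l = 2" | "k = Suc 0" "l = 3" | "k = 2" "l = 3"
      by linarith
    then show ?thesis
      using fmap_coincidence[OF that(3,4)] that(5) comp by cases auto
  qed
  show ?thesis
    using False ordered[of i j p q] ordered[of j i q p] assms by (cases "i < j") auto
qed

lemma glue_fmap:
  assumes "compatible f" "i < 4" "x \<in> K"
  shows "glue f (fmap i x) = f i x"
  unfolding glue_def
proof (rule some_equality)
  show "\<exists>j<4. \<exists>y\<in>K. fmap i x = fmap j y \<and> f i x = f j y" using assms by blast
next
  fix t assume "\<exists>j<4. \<exists>y\<in>K. fmap i x = fmap j y \<and> t = f j y"
  then show "t = f i x" using compatible_eq[OF assms(1,2)] assms(3) by metis
qed

text \<open>
  The preimage of a closed set is the union of four continuous images of compact sets.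
\<close>

lemma continuous_on_glue:
  assumes "compatible f" and cont: "\<And>i. i < 4 \<Longrightarrow> continuous_on K (f i)"
  shows "continuous_on K (glue f)"
  unfolding continuous_on_closed_vimage[OF closed_K]
proof (intro allI impI)
  fix B :: "real set" assume "closed B"
  have "glue f -` B \<inter> K = (\<Union>i<4. fmap i ` (f i -` B \<inter> K))"
  proof (intro set_eqI iffI)
    fix p assume p: "p \<in> glue f -` B \<inter> K"
    then obtain i y where "i < 4" "y \<in> K" "p = fmap i y" by (blast elim: K_cases)
    then show "p \<in> (\<Union>i<4. fmap i ` (f i -` B \<inter> K))"
      using p by (auto simp: glue_fmap[OF assms(1)])
  next
    fix p assume "p \<in> (\<Union>i<4. fmap i ` (f i -` B \<inter> K))"
    then show "p \<in> glue f -` B \<inter> K"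
      by (auto simp: glue_fmap[OF assms(1)] fmap_in_K)
  qed
  moreover have "compact (fmap i ` (f i -` B \<inter> K))" if "i < 4" for i
  proof (rule compact_continuous_image[OF continuous_on_fmap])
    have "closed (f i -` B \<inter> K)"
      using cont[OF that] \<open>closed B\<close> unfolding continuous_on_closed_vimage[OF closed_K] by blast
    then have "compact (K \<inter> (f i -` B \<inter> K))" by (rule compact_Int_closed[OF compact_K])
    then show "compact (f i -` B \<inter> K)" by (simp add: Int_commute Int_left_commute)
  qed
  ultimately show "closed (glue f -` B \<inter> K)"
    by (auto intro!: closed_UN compact_imp_closed)
qed

section \<open>The approximating bilinear forms\<close>

text \<open>
  This is the polarization of \<open>form_n\<close>, written by recursion on the first letter of the words, with
  the factor \<open>2 = 1 / scale i\<close> per letter. Self-similar functions can then be handled by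
  induction on the level.
\<close>

primrec bform :: "nat \<Rightarrow> (point \<Rightarrow> real) \<Rightarrow> (point \<Rightarrow> real) \<Rightarrow> real" where
  "bform 0 u v = (u q\<^sub>1 - u q\<^sub>2) * (v q\<^sub>1 - v q\<^sub>2) + (u q\<^sub>1 - u q\<^sub>3) * (v q\<^sub>1 - v q\<^sub>3)"
| "bform (Suc n) u v = 2 * (\<Sum>i<4. bform n (u \<circ> fmap i) (v \<circ> fmap i))"

lemma words_0: "words 0 = {[]}"
  by (auto simp: words_def)

lemma words_Suc: "words (Suc n) = (\<lambda>(i, \<omega>). i # \<omega>) ` ({..<4} \<times> words n)"
  by (force simp: words_def length_Suc_conv image_def)

lemma inverse_scale_word_Cons: "inverse (scale_word (i # \<omega>)) = 2 * inverse (scale_word \<omega>)"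
  unfolding scale_word_def scale_def list.map prod_list.Cons inverse_mult_distrib by simp

lemma form_n_eq_bform: "form_n n u = bform n u u"
proof (induction n arbitrary: u)
  case 0
  then show ?case by (simp add: form_n_def words_0 scale_word_def form_0_def power2_eq_square)
next
  case (Suc n)
  have inj: "inj_on (\<lambda>(i, \<omega>). i # \<omega>) ({..<4::nat} \<times> words n)" by (auto simp: inj_on_def)
  have "form_n (Suc n) u = (\<Sum>i<4. \<Sum>\<omega>\<in>words n.
      inverse (scale_word (i # \<omega>)) * form_0 (u \<circ> fword (i # \<omega>)))"
    unfolding form_n_def words_Suc sum.reindex[OF inj] sum.cartesian_product
    by (simp add: case_prod_unfold)
  also have "\<dots> = 2 * (\<Sum>i<4. form_n n (u \<circ> fmap i))"
    unfolding form_n_def sum_distrib_left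
    by (intro sum.cong refl) (simp add: inverse_scale_word_Cons comp_assoc mult.assoc)
  finally show ?case by (simp only: Suc bform.simps)
qed

lemma sum_less_4: "(\<Sum>i<4. g i) = g 0 + g (Suc 0) + g 2 + g (3::nat)"
  by (simp add: eval_nat_numeral lessThan_Suc ac_simps)

lemma bform_cong:
  assumes "\<And>x. x \<in> K \<Longrightarrow> u x = u' x" "\<And>x. x \<in> K \<Longrightarrow> v x = v' x"
  shows "bform n u v = bform n u' v'"
  using assms
proof (induction n arbitrary: u u' v v')
  case 0
  then show ?case using q_in_K by simp
next
  case (Suc n)
  have "bform n (u \<circ> fmap i) (v \<circ> fmap i) = bform n (u' \<circ> fmap i) (v' \<circ> fmap i)" if "i < 4" for i
    by (rule Suc.IH) (simp_all add: Suc.prems fmap_in_K[OF that])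
  then show ?case by simp
qed

lemma bform_sym: "bform n u v = bform n v u"
  by (induction n arbitrary: u v) (simp_all add: algebra_simps)

lemma bform_lin: "bform n (\<lambda>x. a * u x + b * u' x) v = a * bform n u v + b * bform n u' v"
proof (induction n arbitrary: u u' v)
  case 0
  then show ?case by (simp add: algebra_simps)
next
  case (Suc n)
  have "bform n ((\<lambda>x. a * u x + b * u' x) \<circ> fmap i) (v \<circ> fmap i)
      = a * bform n (u \<circ> fmap i) (v \<circ> fmap i) + b * bform n (u' \<circ> fmap i) (v \<circ> fmap i)" for i
    using Suc[of "u \<circ> fmap i" "u' \<circ> fmap i"] by (simp add: o_def)
  then show ?case by (simp add: sum.distrib sum_distrib_left algebra_simps)
qed

lemma bform_const: "bform n (\<lambda>_. c) v = 0"
proof (induction n arbitrary: v)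
  case (Suc n)
  then show ?case by (simp add: o_def)
qed simp

lemma bform_lin2: "bform n (\<lambda>x. a * u x + b * v x) (\<lambda>x. a * u x + b * v x)
    = a\<^sup>2 * bform n u u + 2 * a * b * bform n u v + b\<^sup>2 * bform n v v"
  by (simp add: bform_lin bform_sym[of n _ "\<lambda>x. a * u x + b * v x"] bform_sym[of n v u]
      power2_eq_square algebra_simps)

lemma bform_nonneg: "0 \<le> bform n u u"
  by (induction n arbitrary: u) (simp_all add: sum_nonneg)

text \<open>
  Two resistors of half the size in series replace one, which is the inequality \<open>split\<close>; the new
  dead ends only add energy.
\<close>

lemma bform_mono_Suc: "bform n u u \<le> bform (Suc n) u u"
proof (induction n arbitrary: u)
  case 0
  have split: "(a - c)\<^sup>2 \<le> 2 * ((a - b)\<^sup>2 + (b - c)\<^sup>2)" for a b c :: real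
  proof -
    have "2 * ((a - b)\<^sup>2 + (b - c)\<^sup>2) - (a - c)\<^sup>2 = (a - 2 * b + c)\<^sup>2"
      by (simp add: power2_eq_square algebra_simps)
    then show ?thesis using zero_le_power2[of "a - 2 * b + c"] by linarith
  qed
  have nn: "0 \<le> (u q\<^sub>1 - u (fmap 0 q\<^sub>3))\<^sup>2" "0 \<le> (u q\<^sub>1 - u (fmap (Suc 0) q\<^sub>2))\<^sup>2"
    "0 \<le> (u (fmap 0 q\<^sub>2) - u (fmap 2 q\<^sub>3))\<^sup>2" "0 \<le> (u (fmap (Suc 0) q\<^sub>3) - u (fmap 3 q\<^sub>2))\<^sup>2"
    by simp_all
  show ?case
    using split[of "u q\<^sub>1" "u q\<^sub>2" "u (fmap 0 q\<^sub>2)"] split[of "u q\<^sub>1" "u q\<^sub>3" "u (fmap (Suc 0) q\<^sub>3)"] nn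
    by (simp only: sum_less_4 fmap_q bform.simps o_apply power2_eq_square[symmetric] distrib_left)
next
  case (Suc n)
  have "(\<Sum>i<4. bform n (u \<circ> fmap i) (u \<circ> fmap i))
      \<le> (\<Sum>i<4. bform (Suc n) (u \<circ> fmap i) (u \<circ> fmap i))"
    by (rule sum_mono) (rule Suc)
  then show ?case by (simp only: bform.simps(2)[of n u] bform.simps(2)[of "Suc n" u])
qed

lemma bform_glue:
  assumes "compatible f"
  shows "bform (Suc n) (glue f) v = 2 * (\<Sum>i<4. bform n (f i) (v \<circ> fmap i))"
proof -
  have "bform n (glue f \<circ> fmap i) (v \<circ> fmap i) = bform n (f i) (v \<circ> fmap i)" if "i < 4" for i
    by (rule bform_cong) (simp_all add: glue_fmap[OF assms that])
  then show ?thesis by simp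
qed

section \<open>Energy and the form domain\<close>

definition real_energy :: "(point \<Rightarrow> real) \<Rightarrow> real" where
  "real_energy u = real_of_ereal (energy u)"

lemma energy_limit: "(\<lambda>n. ereal (bform n u u)) \<longlonglongrightarrow> energy u"
proof -
  have "incseq (\<lambda>n. ereal (bform n u u))"
    by (rule incseq_SucI) (simp add: bform_mono_Suc del: bform.simps)
  then have "(\<lambda>n. ereal (bform n u u)) \<longlonglongrightarrow> (SUP n. ereal (bform n u u))" by (rule LIMSEQ_SUP)
  then show ?thesis unfolding energy_def form_n_eq_bform by (metis limI)
qed

lemma bform_le_energy: "ereal (bform n u u) \<le> energy u"
  by (rule incseq_le[OF incseq_SucI energy_limit]) (simp add: bform_mono_Suc del: bform.simps)

lemma energy_le:
  assumes "\<And>n. n \<ge> N \<Longrightarrow> bform n u u \<le> B"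
  shows "energy u \<le> ereal B"
  by (rule Lim_bounded[OF energy_limit, of N]) (use assms in auto)

lemma energy_nonneg: "0 \<le> energy u"
  using bform_le_energy[of 0 u] bform_nonneg[of 0 u] order_trans by (metis ereal_less_eq(5))

lemma ereal_real_energy: "u \<in> form_domain \<Longrightarrow> ereal (real_energy u) = energy u"
  using energy_nonneg[of u] by (auto simp: form_domain_def real_energy_def ereal_real')

lemma real_energy_limit: "u \<in> form_domain \<Longrightarrow> (\<lambda>n. bform n u u) \<longlonglongrightarrow> real_energy u"
  using energy_limit[of u] ereal_real_energy[of u] by (metis lim_ereal)

lemma bform_le_real_energy: "u \<in> form_domain \<Longrightarrow> bform n u u \<le> real_energy u"
  using bform_le_energy[of n u] ereal_real_energy[of u] by (metis ereal_less_eq(3))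

lemma real_energy_nonneg: "u \<in> form_domain \<Longrightarrow> 0 \<le> real_energy u"
  using bform_le_real_energy[of u 0] bform_nonneg[of 0 u] by linarith

lemma form_domain_energy_leI:
  assumes "continuous_on K u" "\<And>n. n \<ge> N \<Longrightarrow> bform n u u \<le> B"
  shows "u \<in> form_domain" "real_energy u \<le> B"
proof -
  have e: "energy u \<le> ereal B" by (rule energy_le[OF assms(2)])
  then have "energy u < \<infinity>" using order_le_less_trans[of _ "ereal B" "\<infinity>"] by simp
  then show u: "u \<in> form_domain" using assms(1) by (simp add: form_domain_def)
  show "real_energy u \<le> B" using e ereal_real_energy[OF u] by (metis ereal_less_eq(3))
qed

lemma form_domain_lin:
  assumes "u \<in> form_domain" "v \<in> form_domain"
  shows "(\<lambda>x. a * u x + b * v x) \<in> form_domain"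
proof (rule form_domain_energy_leI(1))
  show "continuous_on K (\<lambda>x. a * u x + b * v x)"
    using assms by (intro continuous_intros) (simp_all add: form_domain_def)
  fix n :: nat
  have "0 \<le> bform n (\<lambda>x. a * u x + (- b) * v x) (\<lambda>x. a * u x + (- b) * v x)" by (rule bform_nonneg)
  then have "bform n (\<lambda>x. a * u x + b * v x) (\<lambda>x. a * u x + b * v x)
      \<le> 2 * a\<^sup>2 * bform n u u + 2 * b\<^sup>2 * bform n v v"
    unfolding bform_lin2 by (simp add: algebra_simps)
  also have "\<dots> \<le> 2 * a\<^sup>2 * real_energy u + 2 * b\<^sup>2 * real_energy v"
    using assms by (intro add_mono mult_left_mono bform_le_real_energy) simp_all
  finally show "bform n (\<lambda>x. a * u x + b * v x) (\<lambda>x. a * u x + b * v x)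
      \<le> 2 * a\<^sup>2 * real_energy u + 2 * b\<^sup>2 * real_energy v" .
qed

lemma const_form_domain: "(\<lambda>_. c) \<in> form_domain" and real_energy_const: "real_energy (\<lambda>_. c) = 0"
proof -
  show c: "(\<lambda>_. c) \<in> form_domain"
    by (rule form_domain_energy_leI(1)[of _ 0 0]) (simp_all add: bform_const)
  have "real_energy (\<lambda>_. c) \<le> 0"
    by (rule form_domain_energy_leI(2)[of _ 0]) (simp_all add: bform_const)
  then show "real_energy (\<lambda>_. c) = 0" using real_energy_nonneg[OF c] by linarith
qed

lemma real_energy_scale:
  assumes "u \<in> form_domain"
  shows "(\<lambda>x. a * u x) \<in> form_domain" "real_energy (\<lambda>x. a * u x) \<le> a\<^sup>2 * real_energy u"
proof -
  have c: "continuous_on K (\<lambda>x. a * u x)"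
    using assms by (intro continuous_intros) (simp add: form_domain_def)
  have b: "bform n (\<lambda>x. a * u x) (\<lambda>x. a * u x) \<le> a\<^sup>2 * real_energy u" for n
    using bform_lin2[of n a u 0 u] bform_le_real_energy[OF assms, of n]
    by (simp add: mult_left_mono)
  show "(\<lambda>x. a * u x) \<in> form_domain" "real_energy (\<lambda>x. a * u x) \<le> a\<^sup>2 * real_energy u"
    by (rule form_domain_energy_leI[OF c b])+
qed

lemma real_energy_fmap:
  assumes "u \<in> form_domain" "i < 4"
  shows "u \<circ> fmap i \<in> form_domain" "real_energy (u \<circ> fmap i) \<le> real_energy u / 2"
proof -
  have c: "continuous_on K (u \<circ> fmap i)"
  proof (rule continuous_on_compose[OF continuous_on_fmap])
    show "continuous_on (fmap i ` K) u"
      using assms fmap_in_K by (auto simp: form_domain_def intro: continuous_on_subset)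
  qed
  have b: "bform n (u \<circ> fmap i) (u \<circ> fmap i) \<le> real_energy u / 2" for n
  proof -
    have "bform n (u \<circ> fmap i) (u \<circ> fmap i) \<le> (\<Sum>i<4. bform n (u \<circ> fmap i) (u \<circ> fmap i))"
      using assms(2) by (intro member_le_sum) (simp_all add: bform_nonneg)
    then show ?thesis using bform_le_real_energy[OF assms(1), of "Suc n"] by simp
  qed
  show "u \<circ> fmap i \<in> form_domain" "real_energy (u \<circ> fmap i) \<le> real_energy u / 2"
    by (rule form_domain_energy_leI[OF c b])+
qed

lemma real_energy_fword:
  assumes "u \<in> form_domain" "set \<omega> \<subseteq> {..<4}"
  shows "u \<circ> fword \<omega> \<in> form_domain \<and> real_energy (u \<circ> fword \<omega>) \<le> real_energy u / 2 ^ length \<omega>"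
  using assms
proof (induction \<omega> arbitrary: u)
  case Nil
  then show ?case by simp
next
  case (Cons i \<omega>)
  then have "i < 4" by simp
  note fm = real_energy_fmap[OF Cons.prems(1) this]
  have "(u \<circ> fmap i) \<circ> fword \<omega> \<in> form_domain \<and>
      real_energy ((u \<circ> fmap i) \<circ> fword \<omega>) \<le> real_energy (u \<circ> fmap i) / 2 ^ length \<omega>"
    using Cons.prems by (intro Cons.IH fm(1)) simp
  moreover have "real_energy (u \<circ> fmap i) / 2 ^ length \<omega> \<le> real_energy u / 2 / 2 ^ length \<omega>"
    by (rule divide_right_mono[OF fm(2)]) simp
  moreover have "u \<circ> fword (i # \<omega>) = (u \<circ> fmap i) \<circ> fword \<omega>" by (simp add: comp_assoc)
  moreover have "real_energy u / 2 / 2 ^ length \<omega> = real_energy u / 2 ^ length (i # \<omega>)" by simp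
  ultimately show ?case by (metis order_trans)
qed

lemma glue_form_domain:
  assumes "compatible f" "\<And>i. i < 4 \<Longrightarrow> f i \<in> form_domain"
  shows "glue f \<in> form_domain" "real_energy (glue f) \<le> 2 * (\<Sum>i<4. real_energy (f i))"
proof -
  have c: "continuous_on K (glue f)"
    using assms by (intro continuous_on_glue) (simp_all add: form_domain_def)
  have b: "bform n (glue f) (glue f) \<le> 2 * (\<Sum>i<4. real_energy (f i))" if pos: "n \<ge> 1" for n
  proof -
    obtain m where m: "n = Suc m" using pos by (cases n) auto
    have "bform m (f i) (glue f \<circ> fmap i) = bform m (f i) (f i)" if "i < 4" for i
      by (rule bform_cong) (simp_all add: glue_fmap[OF assms(1) that])
    then have "bform n (glue f) (glue f) = 2 * (\<Sum>i<4. bform m (f i) (f i))"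
      unfolding m bform_glue[OF assms(1)] by simp
    also have "\<dots> \<le> 2 * (\<Sum>i<4. real_energy (f i))"
      by (intro mult_left_mono sum_mono bform_le_real_energy assms(2)) simp_all
    finally show ?thesis .
  qed
  show "glue f \<in> form_domain" "real_energy (glue f) \<le> 2 * (\<Sum>i<4. real_energy (f i))"
    by (rule form_domain_energy_leI[OF c b], assumption)+
qed

lemma bform_scale: "bform n (\<lambda>x. a * u x) v = a * bform n u v"
  using bform_lin[of n a u 0 u v] by simp

lemma bform_affine: "bform n (\<lambda>x. c + a * u x) v = a * bform n u v"
  using bform_lin[of n c "\<lambda>_. 1" a u v] by (simp add: bform_const)

text \<open>
  By polarization \<open>bform n u v = 0\<close> means that \<open>u + v\<close> and \<open>u - v\<close> have the same energy at level
  \<open>n\<close>, and the energies are the limits.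
\<close>

lemma form_eq_0:
  assumes "u \<in> form_domain" "v \<in> form_domain" and zero: "\<And>n. n \<ge> N \<Longrightarrow> bform n u v = 0"
  shows "form u v = 0"
proof -
  let ?p = "\<lambda>x. 1 * u x + 1 * v x" and ?m = "\<lambda>x. 1 * u x + (- 1) * v x"
  have eq: "bform n ?p ?p = bform n ?m ?m" if "n \<ge> N" for n
    unfolding bform_lin2 using zero[OF that] by simp
  have lims: "(\<lambda>n. bform n ?p ?p) \<longlonglongrightarrow> real_energy ?p" "(\<lambda>n. bform n ?m ?m) \<longlonglongrightarrow> real_energy ?m"
    using assms by (intro real_energy_limit form_domain_lin; simp)+
  moreover have "\<forall>\<^sub>F n in sequentially. bform n ?p ?p = bform n ?m ?m"
    unfolding eventually_sequentially using eq by blast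
  ultimately have "(\<lambda>n. bform n ?m ?m) \<longlonglongrightarrow> real_energy ?p" by (blast intro: Lim_transform_eventually)
  then have "real_energy ?p = real_energy ?m" using lims(2) by (rule LIMSEQ_unique)
  then show ?thesis by (simp add: form_def real_energy_def)
qed

text \<open>
  If \<open>bform n u\<close> vanishes on the approximating functions \<open>\<psi> k\<close>, it takes the same value \<open>\<beta>\<close> on all the differences
  \<open>\<phi> - \<psi> k\<close>. Positivity of the form on \<open>(\<phi> - \<psi> k) + t u\<close> gives in the limit
  \<open>0 \<le> 2 t \<beta> + t\<^sup>2 E\<close> for all \<open>t\<close>, which forces \<open>\<beta> = 0\<close>.
\<close>

lemma bform_zero_completion:
  assumes u: "u \<in> form_domain" and \<phi>: "\<phi> \<in> form_domain_on \<mu> U"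
    and zero: "\<And>\<psi>. \<psi> \<in> form_domain \<Longrightarrow> supp \<psi> \<subseteq> U \<Longrightarrow> bform n u \<psi> = 0"
  shows "bform n u \<phi> = 0"
proof -
  obtain \<psi> where \<phi>': "\<phi> \<in> form_domain" and \<psi>: "\<And>k. \<psi> k \<in> form_domain" "\<And>k. supp (\<psi> k) \<subseteq> U"
    and lim: "(\<lambda>k. form_norm \<mu> (\<lambda>x. \<phi> x - \<psi> k x)) \<longlonglongrightarrow> 0"
    using \<phi> unfolding form_domain_on_def by blast
  define \<beta> E where "\<beta> = bform n u \<phi>" and "E = bform n u u"
  have quad: "0 \<le> 2 * t * \<beta> + t\<^sup>2 * E" for t
  proof (rule LIMSEQ_le_const)
    show "(\<lambda>k. (form_norm \<mu> (\<lambda>x. \<phi> x - \<psi> k x))\<^sup>2 + 2 * t * \<beta> + t\<^sup>2 * E) \<longlonglongrightarrow> 2 * t * \<beta> + t\<^sup>2 * E"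
      using tendsto_add[OF tendsto_add[OF tendsto_power[OF lim, of 2] tendsto_const] tendsto_const] by simp
    show "\<exists>N. \<forall>k\<ge>N. 0 \<le> (form_norm \<mu> (\<lambda>x. \<phi> x - \<psi> k x))\<^sup>2 + 2 * t * \<beta> + t\<^sup>2 * E"
    proof (intro exI allI impI)
      fix k
      define d where "d = (\<lambda>x. \<phi> x - \<psi> k x)"
      have d: "d \<in> form_domain"
        using form_domain_lin[OF \<phi>' \<psi>(1)[of k], of 1 "- 1"] by (simp add: d_def)
      have ud: "bform n d u = \<beta>"
        using bform_lin[of n 1 \<phi> "- 1" "\<psi> k" u] zero[OF \<psi>[of k]]
        by (simp add: \<beta>_def d_def bform_sym[of n _ u])
      have "0 \<le> (\<integral>x. (d x)\<^sup>2 \<partial>\<mu>)" by simp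
      then have "real_energy d \<le> (form_norm \<mu> d)\<^sup>2"
        using real_energy_nonneg[OF d] by (simp add: form_norm_def real_energy_def)
      moreover have "0 \<le> bform n d d + 2 * t * \<beta> + t\<^sup>2 * E"
        using bform_nonneg[of n "\<lambda>x. 1 * d x + t * u x"] unfolding bform_lin2 by (simp add: ud E_def)
      ultimately show "0 \<le> (form_norm \<mu> (\<lambda>x. \<phi> x - \<psi> k x))\<^sup>2 + 2 * t * \<beta> + t\<^sup>2 * E"
        using bform_le_real_energy[OF d, of n] unfolding d_def by linarith
    qed
  qed
  have "0 \<le> E" by (simp add: E_def bform_nonneg)
  \<comment> \<open>The quadratic is negative here unless \<open>\<beta> = 0\<close>; the summand 1 covers the case \<open>E = 0\<close>.\<close>
  define t where "t = - \<beta> / (E + 1)"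
  have t: "t * (E + 1) = - \<beta>" using \<open>0 \<le> E\<close> by (simp add: t_def)
  have "(2 * t * \<beta> + t\<^sup>2 * E) * (E + 1)\<^sup>2 = 2 * (t * (E + 1)) * \<beta> * (E + 1) + (t * (E + 1))\<^sup>2 * E"
    by (simp add: power2_eq_square algebra_simps)
  also have "\<dots> = - (\<beta>\<^sup>2 * (E + 2))"
    unfolding t by (simp add: power2_eq_square algebra_simps)
  finally have "0 \<le> - (\<beta>\<^sup>2 * (E + 2))" using mult_nonneg_nonneg[OF quad[of t], of "(E + 1)\<^sup>2"] by simp
  then have "\<beta>\<^sup>2 * (E + 2) \<le> 0" by simp
  then have "\<beta> = 0" using \<open>0 \<le> E\<close> by (simp add: mult_le_0_iff)
  then show ?thesis by (simp add: \<beta>_def)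
qed

section \<open>The harmonic function carried by one leg\<close>

text \<open>
  The value of \<open>leg\<close> rises from 0 to 1/2 along cell 0 and from 1/2 to 1 along cell 2; cells 1 and 3
  hang off \<open>q\<^sub>1\<close>, where it is 0. The function is the limit of iterating this rule, which halves
  uniform distances. The start value is arbitrary among continuous functions with values in
  \<open>[0, 1]\<close> that are right at \<open>q\<^sub>1\<close> and \<open>q\<^sub>2\<close>.
\<close>

definition leg_step :: "(point \<Rightarrow> real) \<Rightarrow> point \<Rightarrow> real" where
  "leg_step f = glue ((!) [\<lambda>x. f x / 2, \<lambda>_. 0, \<lambda>x. 1 / 2 + f x / 2, \<lambda>_. 0])"

definition leg_approx :: "nat \<Rightarrow> point \<Rightarrow> real" where
  "leg_approx n = (leg_step ^^ n) (\<lambda>p. min 1 (norm p))"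

definition leg :: "point \<Rightarrow> real" where
  "leg x = lim (\<lambda>n. leg_approx n x)"

lemma leg_step_compatible:
  assumes "f q\<^sub>1 = 0" "f q\<^sub>2 = 1"
  shows "compatible ((!) [\<lambda>x. f x / 2, \<lambda>_. 0, \<lambda>x. 1 / 2 + f x / 2, \<lambda>_. 0])"
  using assms by (simp add: compatible_def)

lemma leg_step_fmap:
  assumes "f q\<^sub>1 = 0" "f q\<^sub>2 = 1" "x \<in> K"
  shows "leg_step f (fmap 0 x) = f x / 2" "leg_step f (fmap (Suc 0) x) = 0"
    "leg_step f (fmap 2 x) = 1 / 2 + f x / 2" "leg_step f (fmap 3 x) = 0"
  using glue_fmap[OF leg_step_compatible[OF assms(1,2)] _ assms(3)] by (simp_all add: leg_step_def)

lemma leg_approx_Suc: "leg_approx (Suc n) = leg_step (leg_approx n)"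
  by (simp add: leg_approx_def)

lemma leg_approx_ends: "leg_approx n q\<^sub>1 = 0" "leg_approx n q\<^sub>2 = 1"
proof -
  have "leg_approx n q\<^sub>1 = 0 \<and> leg_approx n q\<^sub>2 = 1"
  proof (induction n)
    case 0
    have "norm q\<^sub>1 = 0" by (simp add: q\<^sub>1_def)
    moreover have "1 \<le> norm q\<^sub>2"
      by (simp add: q\<^sub>2_def norm_Pair)
    ultimately show ?case by (simp add: leg_approx_def)
  next
    case (Suc n)
    then show ?case
      using leg_step_fmap(1)[of "leg_approx n" q\<^sub>1] leg_step_fmap(3)[of "leg_approx n" q\<^sub>2] q_in_K
      by (simp add: leg_approx_Suc fmap_q)
  qed
  then show "leg_approx n q\<^sub>1 = 0" "leg_approx n q\<^sub>2 = 1" by blast+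
qed

lemma leg_approx_fmap:
  assumes "x \<in> K"
  shows "leg_approx (Suc n) (fmap 0 x) = leg_approx n x / 2" "leg_approx (Suc n) (fmap (Suc 0) x) = 0"
    "leg_approx (Suc n) (fmap 2 x) = 1 / 2 + leg_approx n x / 2" "leg_approx (Suc n) (fmap 3 x) = 0"
  using leg_step_fmap[of "leg_approx n" x] leg_approx_ends assms by (simp_all add: leg_approx_Suc)

lemma fmap_cases:
  assumes "x \<in> K"
  obtains y where "y \<in> K" "x = fmap 0 y" | y where "y \<in> K" "x = fmap (Suc 0) y"
    | y where "y \<in> K" "x = fmap 2 y" | y where "y \<in> K" "x = fmap 3 y"
  using K_cases[OF assms] less_4_cases by metis

lemma leg_approx_range:
  assumes "x \<in> K"
  shows "0 \<le> leg_approx n x \<and> leg_approx n x \<le> 1"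
  using assms
proof (induction n arbitrary: x)
  case 0
  then show ?case by (simp add: leg_approx_def)
next
  case (Suc n)
  from \<open>x \<in> K\<close> show ?case
    by (cases rule: fmap_cases) (use Suc.IH in \<open>force simp: leg_approx_fmap\<close>)+
qed

lemma leg_approx_diff:
  assumes "x \<in> K"
  shows "\<bar>leg_approx (n + j) x - leg_approx n x\<bar> \<le> (1 / 2) ^ n"
  using assms
proof (induction n arbitrary: x)
  case 0
  then show ?case using leg_approx_range[of x j] leg_approx_range[of x 0] by auto
next
  case (Suc n)
  have half: "\<bar>a / 2 - b / 2\<bar> \<le> (1 / 2) ^ Suc n" if "\<bar>a - b\<bar> \<le> (1 / 2) ^ n" for a b :: real
  proof -
    have "\<bar>a / 2 - b / 2\<bar> = \<bar>a - b\<bar> / 2" by (simp add: diff_divide_distrib[symmetric])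
    then show ?thesis using that by simp
  qed
  from \<open>x \<in> K\<close> show ?case
    by (cases rule: fmap_cases) (use half[OF Suc.IH] in \<open>simp_all add: leg_approx_fmap\<close>)
qed

lemma continuous_on_leg_approx: "continuous_on K (leg_approx n)"
proof (induction n)
  case 0
  show ?case unfolding leg_approx_def by (simp, intro continuous_intros)
next
  case (Suc n)
  show ?case unfolding leg_approx_Suc leg_step_def
    by (rule continuous_on_glue[OF leg_step_compatible[OF leg_approx_ends]])
      (auto simp: less_4_cases intro!: continuous_intros Suc)
qed

lemma leg_uniform_limit: "uniform_limit K leg_approx leg sequentially"
proof -
  have "uniformly_Cauchy_on K leg_approx"
  proof (rule uniformly_Cauchy_onI')
    fix e :: real assume "0 < e"
    then obtain M where M: "(1 / 2) ^ M < e" using real_arch_pow_inv[of e "1 / 2"] by auto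
    show "\<exists>M. \<forall>x\<in>K. \<forall>m\<ge>M. \<forall>n>m. dist (leg_approx m x) (leg_approx n x) < e"
    proof (intro exI[of _ M] ballI allI impI)
      fix x and m n :: nat assume x: "x \<in> K" and mn: "M \<le> m" "m < n"
      have "\<bar>leg_approx n x - leg_approx m x\<bar> \<le> (1 / 2) ^ m"
        using leg_approx_diff[OF x, of m "n - m"] mn by simp
      also have "\<dots> \<le> (1 / 2) ^ M" using mn by (intro power_decreasing) auto
      finally show "dist (leg_approx m x) (leg_approx n x) < e"
        using M by (simp add: dist_real_def abs_minus_commute)
    qed
  qed
  then show ?thesis
    unfolding leg_def[abs_def]
    using Cauchy_uniformly_convergent uniformly_convergent_uniform_limit_iff by blast
qed

lemma leg_limit: "x \<in> K \<Longrightarrow> (\<lambda>n. leg_approx n x) \<longlonglongrightarrow> leg x"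
  using leg_uniform_limit by (rule tendsto_uniform_limitI)

lemma continuous_on_leg: "continuous_on K leg"
  by (rule uniform_limit_theorem[OF _ leg_uniform_limit]) (auto intro!: always_eventually continuous_on_leg_approx)

lemma leg_range: "x \<in> K \<Longrightarrow> 0 \<le> leg x" "x \<in> K \<Longrightarrow> leg x \<le> 1"
  using LIMSEQ_le_const[OF leg_limit] LIMSEQ_le_const2[OF leg_limit] leg_approx_range by blast+

lemma leg_fmap:
  assumes "x \<in> K"
  shows "leg (fmap 0 x) = leg x / 2" "leg (fmap (Suc 0) x) = 0"
    "leg (fmap 2 x) = 1 / 2 + leg x / 2" "leg (fmap 3 x) = 0"
proof -
  have lim: "(\<lambda>n. leg_approx (Suc n) (fmap i x)) \<longlonglongrightarrow> leg (fmap i x)" if "i < 4" for i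
    by (rule LIMSEQ_Suc[OF leg_limit[OF fmap_in_K[OF that assms]]])
  have "(\<lambda>n. leg_approx n x / 2) \<longlonglongrightarrow> leg (fmap 0 x)"
    using lim[of 0] by (simp add: leg_approx_fmap[OF assms])
  moreover have "(\<lambda>n. leg_approx n x / 2) \<longlonglongrightarrow> leg x / 2"
    by (intro tendsto_intros leg_limit assms) simp
  ultimately show "leg (fmap 0 x) = leg x / 2" by (rule LIMSEQ_unique)
  have "(\<lambda>n. 1 / 2 + leg_approx n x / 2) \<longlonglongrightarrow> leg (fmap 2 x)"
    using lim[of 2] by (simp add: leg_approx_fmap[OF assms])
  moreover have "(\<lambda>n. 1 / 2 + leg_approx n x / 2) \<longlonglongrightarrow> 1 / 2 + leg x / 2"
    by (intro tendsto_intros leg_limit assms) simp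
  ultimately show "leg (fmap 2 x) = 1 / 2 + leg x / 2" by (rule LIMSEQ_unique)
  show "leg (fmap (Suc 0) x) = 0" "leg (fmap 3 x) = 0"
    using lim[of "Suc 0"] lim[of 3] by (simp_all add: leg_approx_fmap[OF assms] LIMSEQ_const_iff)
qed

lemma leg_ends: "leg q\<^sub>1 = 0" "leg q\<^sub>2 = 1" "leg q\<^sub>3 = 0"
  using leg_fmap(1)[OF q_in_K(1)] leg_fmap(3)[OF q_in_K(2)] leg_fmap(4)[OF q_in_K(3)]
  by (simp_all add: fmap_q)

text \<open>
  A unit current flows from \<open>q\<^sub>1\<close> to \<open>q\<^sub>2\<close>: the contributions of cells 0 and 2 telescope at their
  common point, and those of cells 1 and 3 are zero.
\<close>

lemma bform_leg: "bform n leg v = v q\<^sub>2 - v q\<^sub>1"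
proof (induction n arbitrary: v)
  case 0
  show ?case by (simp add: leg_ends)
next
  case (Suc n)
  have "bform n (leg \<circ> fmap 0) w = bform n (\<lambda>x. 1 / 2 * leg x) w"
    "bform n (leg \<circ> fmap (Suc 0)) w = bform n (\<lambda>_. 0) w"
    "bform n (leg \<circ> fmap 2) w = bform n (\<lambda>x. 1 / 2 + 1 / 2 * leg x) w"
    "bform n (leg \<circ> fmap 3) w = bform n (\<lambda>_. 0) w" for w
    by (rule bform_cong; simp add: leg_fmap)+
  then show ?case
    by (simp only: bform.simps sum_less_4 bform_affine bform_scale bform_const Suc) (simp add: fmap_q field_simps)
qed

text \<open>
  The boundary values of \<open>leg\<close> make the gluings below compatible and are reproduced by them, so
  the gluings can be iterated.
\<close>

definition bump :: "(point \<Rightarrow> real) \<Rightarrow> bool" where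
  "bump f \<longleftrightarrow> f \<in> form_domain \<and> f q\<^sub>1 = 0 \<and> f q\<^sub>2 = 1 \<and> f q\<^sub>3 = 0 \<and> (\<forall>x\<in>K. 0 \<le> f x \<and> f x \<le> 1)"

lemma bump_leg: "bump leg"
  unfolding bump_def
  using form_domain_energy_leI(1)[OF continuous_on_leg, of 0 1]
  by (simp add: bform_leg leg_ends leg_range)

text \<open>
  Iterating \<open>spread\<close> puts a copy of \<open>f\<close> into every cell \<open>F\<^sub>\<omega>(K)\<close> with \<open>\<omega> \<in> {0,1}\<^sup>n\<close>, while
  \<open>single_out\<close> fills only the cell \<open>\<omega> = 0\<dots>0\<close>; cells 2 and 3 receive the constants that continuity
  dictates.
\<close>

definition spread :: "(point \<Rightarrow> real) \<Rightarrow> point \<Rightarrow> real" where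
  "spread f = glue ((!) [f, f, \<lambda>_. 1, \<lambda>_. 0])"

definition single_out :: "(point \<Rightarrow> real) \<Rightarrow> point \<Rightarrow> real" where
  "single_out f = glue ((!) [f, \<lambda>_. 0, \<lambda>_. 1, \<lambda>_. 0])"

lemma bump_compatible:
  assumes "bump f"
  shows "compatible ((!) [f, f, \<lambda>_. 1, \<lambda>_. 0])" "compatible ((!) [f, \<lambda>_. 0, \<lambda>_. 1, \<lambda>_. 0])"
  using assms by (simp_all add: compatible_def bump_def)

lemma spread_fmap:
  assumes "bump f" "x \<in> K"
  shows "spread f (fmap 0 x) = f x" "spread f (fmap (Suc 0) x) = f x"
    "spread f (fmap 2 x) = 1" "spread f (fmap 3 x) = 0"
  using glue_fmap[OF bump_compatible(1)[OF assms(1)] _ assms(2)] by (simp_all add: spread_def)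

lemma single_out_fmap:
  assumes "bump f" "x \<in> K"
  shows "single_out f (fmap 0 x) = f x" "single_out f (fmap (Suc 0) x) = 0"
    "single_out f (fmap 2 x) = 1" "single_out f (fmap 3 x) = 0"
  using glue_fmap[OF bump_compatible(2)[OF assms(1)] _ assms(2)] by (simp_all add: single_out_def)

lemma bump_spread:
  assumes "bump f"
  shows "bump (spread f)"
proof -
  have "spread f \<in> form_domain" unfolding spread_def
    by (rule glue_form_domain(1)[OF bump_compatible(1)[OF assms]])
      (use assms in \<open>auto simp: less_4_cases bump_def const_form_domain\<close>)
  moreover have "0 \<le> spread f x \<and> spread f x \<le> 1" if "x \<in> K" for x
    using that by (cases rule: fmap_cases) (use assms in \<open>auto simp: spread_fmap bump_def\<close>)
  ultimately show ?thesis
    using spread_fmap(1)[OF assms q_in_K(1)] spread_fmap(3)[OF assms q_in_K(2)]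
      spread_fmap(4)[OF assms q_in_K(3)] assms
    by (simp add: bump_def fmap_q)
qed

lemma bump_single_out:
  assumes "bump f"
  shows "bump (single_out f)"
proof -
  have "single_out f \<in> form_domain" unfolding single_out_def
    by (rule glue_form_domain(1)[OF bump_compatible(2)[OF assms]])
      (use assms in \<open>auto simp: less_4_cases bump_def const_form_domain\<close>)
  moreover have "0 \<le> single_out f x \<and> single_out f x \<le> 1" if "x \<in> K" for x
    using that by (cases rule: fmap_cases) (use assms in \<open>auto simp: single_out_fmap bump_def\<close>)
  ultimately show ?thesis
    using single_out_fmap(1)[OF assms q_in_K(1)] single_out_fmap(3)[OF assms q_in_K(2)]
      single_out_fmap(4)[OF assms q_in_K(3)] assms
    by (simp add: bump_def fmap_q)
qed

lemma bump_funpow: "bump ((spread ^^ n) leg)" "bump ((single_out ^^ n) leg)"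
  by (induction n) (simp_all add: bump_leg bump_spread bump_single_out)

section \<open>Words at the root\<close>

lemma fword_append: "fword (\<omega> @ \<nu>) x = fword \<omega> (fword \<nu> x)"
  by (induction \<omega>) simp_all

lemma fword_in_K: "set \<omega> \<subseteq> {..<4} \<Longrightarrow> x \<in> K \<Longrightarrow> fword \<omega> x \<in> K"
  by (induction \<omega>) (simp_all add: fmap_in_K)

lemma root_word_4: "set \<omega> \<subseteq> {..<2::nat} \<Longrightarrow> set \<omega> \<subseteq> {..<4}"
  by auto

lemma fword_root: "set \<omega> \<subseteq> {..<2} \<Longrightarrow> fword \<omega> q\<^sub>1 = q\<^sub>1"
  by (induction \<omega>) (auto simp: less_2_cases_iff fmap_q)

lemma spread_fword:
  assumes "set \<omega> \<subseteq> {..<2}" "x \<in> K"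
  shows "(spread ^^ length \<omega>) leg (fword \<omega> x) = leg x"
  using assms
proof (induction \<omega>)
  case (Cons i \<omega>)
  then have "fword \<omega> x \<in> K" using fword_in_K root_word_4 by simp
  with Cons show ?case by (auto simp: less_2_cases_iff spread_fmap bump_funpow)
qed simp

lemma single_out_fword:
  assumes "x \<in> K"
  shows "(single_out ^^ n) leg (fword (replicate n 0) x) = leg x"
proof (induction n)
  case (Suc n)
  have "fword (replicate n 0) x \<in> K" by (rule fword_in_K[OF _ assms]) auto
  with Suc show ?case by (simp add: single_out_fmap bump_funpow)
qed simp

lemma leg_fword_0: "x \<in> K \<Longrightarrow> leg (fword (replicate k 0) x) = leg x / 2 ^ k"
proof (induction k)
  case (Suc k)
  then have "fword (replicate k 0) x \<in> K" by (intro fword_in_K) auto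
  with Suc show ?case by (simp add: leg_fmap)
qed simp

section \<open>A harmonic function with one steep leg\<close>

text \<open>
  When \<open>v\<close> vanishes at the ends of the legs, each copy of \<open>leg\<close> contributes \<open>- v(q\<^sub>1)\<close> times the
  conductance \<open>2\<^sup>n\<close> of its cell. There are \<open>2\<^sup>n\<close> copies in the first lemma and there is one in the second;
  the weight \<open>2\<^sup>n\<close> of the single copy in \<open>steep\<close> balances the two.
\<close>

lemma bform_spread:
  assumes "\<forall>\<omega>. length \<omega> = n \<and> set \<omega> \<subseteq> {..<2} \<longrightarrow> v (fword \<omega> q\<^sub>2) = 0"
  shows "bform (n + m) ((spread ^^ n) leg) v = - (4 ^ n * v q\<^sub>1)"
  using assms
proof (induction n arbitrary: v)
  case 0
  from 0 have "v q\<^sub>2 = 0" by auto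
  then show ?case by (simp add: bform_leg)
next
  case (Suc n)
  have IH: "bform (n + m) ((spread ^^ n) leg) (v \<circ> fmap i) = - (4 ^ n * v q\<^sub>1)" if "i < 2" for i
  proof -
    have "(v \<circ> fmap i) (fword \<omega> q\<^sub>2) = 0" if "length \<omega> = n \<and> set \<omega> \<subseteq> {..<2}" for \<omega>
      using Suc.prems[rule_format, of "i # \<omega>"] that \<open>i < 2\<close> by simp
    then have "bform (n + m) ((spread ^^ n) leg) (v \<circ> fmap i) = - (4 ^ n * (v \<circ> fmap i) q\<^sub>1)"
      by (rule Suc.IH[OF allI, OF impI])
    moreover have "(v \<circ> fmap i) q\<^sub>1 = v q\<^sub>1" using that by (auto simp: less_2_cases_iff fmap_q)
    ultimately show ?thesis by (simp only:)
  qed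
  have "bform (Suc (n + m)) (spread ((spread ^^ n) leg)) v = 2 * (2 * - (4 ^ n * v q\<^sub>1))"
    unfolding spread_def[of "(spread ^^ n) leg"] bform_glue[OF bump_compatible(1)[OF bump_funpow(1)]]
    using IH[of 0] IH[of "Suc 0"] by (simp add: sum_less_4 bform_const)
  then show ?case by (simp del: bform.simps)
qed

lemma bform_single_out:
  assumes "\<forall>\<omega>. length \<omega> = n \<and> set \<omega> \<subseteq> {..<2} \<longrightarrow> v (fword \<omega> q\<^sub>2) = 0"
  shows "bform (n + m) ((single_out ^^ n) leg) v = - (2 ^ n * v q\<^sub>1)"
  using assms
proof (induction n arbitrary: v)
  case 0
  from 0 have "v q\<^sub>2 = 0" by auto
  then show ?case by (simp add: bform_leg)
next
  case (Suc n)
  have "(v \<circ> fmap 0) (fword \<omega> q\<^sub>2) = 0" if "length \<omega> = n \<and> set \<omega> \<subseteq> {..<2}" for \<omega>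
    using Suc.prems[rule_format, of "0 # \<omega>"] that by simp
  then have "bform (n + m) ((single_out ^^ n) leg) (v \<circ> fmap 0) = - (2 ^ n * (v \<circ> fmap 0) q\<^sub>1)"
    by (rule Suc.IH[OF allI, OF impI])
  moreover have "(v \<circ> fmap 0) q\<^sub>1 = v q\<^sub>1" by (simp add: fmap_q)
  ultimately have IH: "bform (n + m) ((single_out ^^ n) leg) (v \<circ> fmap 0) = - (2 ^ n * v q\<^sub>1)"
    by (simp only:)
  have "bform (Suc (n + m)) (single_out ((single_out ^^ n) leg)) v = 2 * - (2 ^ n * v q\<^sub>1)"
    unfolding single_out_def[of "(single_out ^^ n) leg"] bform_glue[OF bump_compatible(2)[OF bump_funpow(2)]]
    using IH by (simp add: sum_less_4 bform_const)
  then show ?case by (simp del: bform.simps)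
qed

text \<open>
  In the coordinates of the cell, this is \<open>1 - leg\<close> on every cell \<open>\<omega> \<in> {0,1}\<^sup>n\<close> but one, and
  \<open>1 + (2\<^sup>n - 1) leg\<close> on the cell \<open>0\<dots>0\<close>. The slopes add up to zero over the \<open>2\<^sup>n\<close> legs.
\<close>

definition steep :: "nat \<Rightarrow> point \<Rightarrow> real" where
  "steep n x = 1 + (2 ^ n * (single_out ^^ n) leg x - (spread ^^ n) leg x)"

lemma steep_form_domain: "steep n \<in> form_domain"
proof -
  have "(\<lambda>x. 2 ^ n * (single_out ^^ n) leg x + (- 1) * (spread ^^ n) leg x) \<in> form_domain"
    using bump_funpow by (intro form_domain_lin) (simp_all add: bump_def)
  from form_domain_lin[OF const_form_domain this, of 1 1 1] show ?thesis
    by (simp add: steep_def[abs_def])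
qed

lemma steep_nonneg: "x \<in> K \<Longrightarrow> 0 \<le> steep n x"
proof -
  assume "x \<in> K"
  then have "0 \<le> (2::real) ^ n * (single_out ^^ n) leg x" "(spread ^^ n) leg x \<le> 1"
    using bump_funpow[of n] by (simp_all add: bump_def)
  then show ?thesis by (simp add: steep_def)
qed

lemma bform_steep:
  assumes "\<forall>\<omega>. length \<omega> = n \<and> set \<omega> \<subseteq> {..<2} \<longrightarrow> v (fword \<omega> q\<^sub>2) = 0"
  shows "bform (n + m) (steep n) v = 0"
proof -
  have "steep n = (\<lambda>x. 1 + 1 * (2 ^ n * (single_out ^^ n) leg x + (- 1) * (spread ^^ n) leg x))"
    by (simp add: steep_def[abs_def])
  then show ?thesis
    unfolding \<open>steep n = _\<close> bform_affine bform_lin bform_spread[OF assms] bform_single_out[OF assms]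
    by (simp add: power_mult_distrib[symmetric] mult.assoc[symmetric])
qed

lemma steep_on_leg:
  assumes "x \<in> K"
  shows "steep n (fword (replicate n 0) x) = 1 + (2 ^ n - 1) * leg x"
proof -
  have "set (replicate n (0::nat)) \<subseteq> {..<2}" by auto
  from spread_fword[OF this assms] single_out_fword[OF assms, of n] show ?thesis
    by (simp add: steep_def algebra_simps)
qed

lemma steep_off_leg:
  assumes "x \<in> K"
  shows "steep (Suc n) (fmap (Suc 0) x) \<le> 1"
proof -
  have "0 \<le> (spread ^^ n) leg x" using bump_funpow(1)[of n] assms by (simp add: bump_def)
  then show ?thesis using assms by (simp add: steep_def spread_fmap single_out_fmap bump_funpow)
qed

section \<open>The resistance to the root\<close>

text \<open>
  If no function in the form domain separates \<open>y\<close> from \<open>q\<^sub>1\<close>, this set is empty and the resistance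
  is the reciprocal of an unspecified real number. This is why bounds on the resistance come with a
  function that separates the two points.
\<close>

definition test_energies :: "point \<Rightarrow> real set" where
  "test_energies y = {real_energy u | u. u \<in> form_domain \<and> u q\<^sub>1 = 0 \<and> u y = 1}"

lemma resistance_root: "y \<noteq> q\<^sub>1 \<Longrightarrow> resistance q\<^sub>1 y = 1 / Inf (test_energies y)"
  by (auto simp: resistance_def test_energies_def real_energy_def)

text \<open>
  The points that satisfy the bound for all \<open>g\<close> at once form a closed set, which is invariant
  under the maps: the passage to a subcell costs \<open>g(F\<^sub>i q\<^sub>1) - g(q\<^sub>1)\<close>, of square at most half the
  energy, and the energy carried by the subcell is at most one half. The constant 9 satisfies
  \<open>4/3 \<cdot> 9/2 + 4 \<cdot> 1/2 \<le> 9\<close>.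
\<close>

lemma root_oscillation:
  assumes "g \<in> form_domain" "y \<in> K"
  shows "(g y - g q\<^sub>1)\<^sup>2 \<le> 9 * real_energy g"
proof -
  define B where "B = K \<inter> (\<Inter>g\<in>form_domain. {y \<in> K. (g y - g q\<^sub>1)\<^sup>2 \<le> 9 * real_energy g})"
  have "closed B"
    unfolding B_def form_domain_def
    by (intro closed_Int closed_K closed_INT ballI continuous_on_closed_Collect_le continuous_intros) auto
  moreover have "q\<^sub>1 \<in> B"
    using q_in_K real_energy_nonneg by (simp add: B_def)
  moreover have "fmap i y \<in> B" if i: "i < 4" and y: "y \<in> B" for i y
  proof -
    have "(g (fmap i y) - g q\<^sub>1)\<^sup>2 \<le> 9 * real_energy g" if g: "g \<in> form_domain" for g
    proof -
      define a b where "a = g (fmap i y) - g (fmap i q\<^sub>1)" and "b = g (fmap i q\<^sub>1) - g q\<^sub>1"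
      have "a\<^sup>2 \<le> 9 * real_energy (g \<circ> fmap i)"
        using y real_energy_fmap(1)[OF g i] unfolding B_def a_def by auto
      then have a: "a\<^sup>2 \<le> 9 / 2 * real_energy g"
        using real_energy_fmap(2)[OF g i] by simp
      have "0 \<le> (g q\<^sub>1 - g (fmap 0 q\<^sub>3))\<^sup>2" "0 \<le> (g q\<^sub>1 - g (fmap (Suc 0) q\<^sub>2))\<^sup>2"
        by simp_all
      then have "(g q\<^sub>1 - g (fmap 0 q\<^sub>2))\<^sup>2 \<le> bform 0 (g \<circ> fmap 0) (g \<circ> fmap 0)"
        "(g q\<^sub>1 - g (fmap (Suc 0) q\<^sub>3))\<^sup>2 \<le> bform 0 (g \<circ> fmap (Suc 0)) (g \<circ> fmap (Suc 0))"
        by (simp_all add: fmap_q power2_eq_square)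
      then have "(g q\<^sub>1 - g (fmap 0 q\<^sub>2))\<^sup>2 \<le> real_energy g / 2"
        "(g q\<^sub>1 - g (fmap (Suc 0) q\<^sub>3))\<^sup>2 \<le> real_energy g / 2"
        using bform_le_real_energy[OF real_energy_fmap(1)[OF g], of _ 0] real_energy_fmap(2)[OF g]
        by (meson order_trans zero_less_numeral one_less_numeral_iff less_4_cases)+
      then have b: "b\<^sup>2 \<le> real_energy g / 2"
        using i real_energy_nonneg[OF g]
        by (auto simp: b_def less_4_cases fmap_q power2_commute[of _ "g q\<^sub>1"])
      \<comment> \<open>The weights of \<open>a\<^sup>2\<close> and \<open>b\<^sup>2\<close> are those of Young's inequality with parameter 3.\<close>
      have "4 / 3 * a\<^sup>2 + 4 * b\<^sup>2 - (a + b)\<^sup>2 = (a - 3 * b)\<^sup>2 / 3"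
        by (simp add: power2_eq_square algebra_simps)
      then have "(a + b)\<^sup>2 \<le> 4 / 3 * a\<^sup>2 + 4 * b\<^sup>2"
        using zero_le_power2[of "a - 3 * b"] by linarith
      also have "\<dots> \<le> 9 * real_energy g"
        using a b real_energy_nonneg[OF g] by linarith
      finally show ?thesis by (simp add: a_def b_def)
    qed
    then show ?thesis using y fmap_in_K[OF i] by (simp add: B_def)
  qed
  ultimately have "K \<subseteq> B" using K_subset_closed_invariant by blast
  then show ?thesis using assms by (auto simp: B_def)
qed

lemma test_energies_ge: "y \<in> K \<Longrightarrow> e \<in> test_energies y \<Longrightarrow> 1 / 9 \<le> e"
proof -
  assume y: "y \<in> K" and "e \<in> test_energies y"
  then obtain u where "u \<in> form_domain" "u q\<^sub>1 = 0" "u y = 1" "e = real_energy u"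
    by (auto simp: test_energies_def)
  then show ?thesis using root_oscillation[OF _ y, of u] by simp
qed

lemma test_energies_normalise:
  assumes "g \<in> form_domain" "g q\<^sub>1 = 0" "g y \<noteq> 0"
  shows "\<exists>e\<in>test_energies y. e \<le> real_energy g / (g y)\<^sup>2"
proof (rule bexI)
  show "real_energy (\<lambda>x. 1 / g y * g x) \<le> real_energy g / (g y)\<^sup>2"
    using real_energy_scale(2)[OF assms(1), of "1 / g y"] by (simp add: power_divide)
  show "real_energy (\<lambda>x. 1 / g y * g x) \<in> test_energies y"
    unfolding test_energies_def using real_energy_scale(1)[OF assms(1), of "1 / g y"] assms by auto
qed

lemma test_energies_nonempty:
  assumes "f \<in> form_domain" "f y \<noteq> f q\<^sub>1"
  shows "test_energies y \<noteq> {}"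
proof -
  have "(\<lambda>x. 1 * f x + (- 1) * f q\<^sub>1) \<in> form_domain"
    by (intro form_domain_lin assms const_form_domain)
  from test_energies_normalise[OF this, of y] show ?thesis using assms(2) by auto
qed

lemma test_energies_bdd: "y \<in> K \<Longrightarrow> bdd_below (test_energies y)"
  using test_energies_ge by (rule bdd_belowI)

lemma Inf_test_energies_pos: "y \<in> K \<Longrightarrow> test_energies y \<noteq> {} \<Longrightarrow> 0 < Inf (test_energies y)"
  using cInf_greatest[of "test_energies y" "1 / 9"] test_energies_ge[of y] by fastforce

lemma resistance_ge:
  assumes "y \<in> K" "f \<in> form_domain" "f q\<^sub>1 = 0" "f y = 1" "real_energy f \<le> B"
  shows "1 / B \<le> resistance q\<^sub>1 y"
proof -
  have mem: "real_energy f \<in> test_energies y" using assms by (auto simp: test_energies_def)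
  then have pos: "0 < Inf (test_energies y)" using Inf_test_energies_pos[OF assms(1)] by blast
  have "Inf (test_energies y) \<le> B"
    using cInf_lower[OF mem test_energies_bdd[OF assms(1)]] assms(5) by simp
  moreover have "y \<noteq> q\<^sub>1" using assms by auto
  ultimately show ?thesis using pos by (simp add: resistance_root frac_le)
qed

text \<open>
  The function \<open>leg\<close> is copied into the single cell \<open>F\<^sub>\<omega>(K)\<close> and extended by constants; every letter
  doubles its energy.
\<close>

lemma root_word_test_function:
  assumes "set \<omega> \<subseteq> {..<2}"
  shows "\<exists>f\<in>form_domain. f q\<^sub>1 = 0 \<and> f (fword \<omega> q\<^sub>2) = 1 \<and> real_energy f \<le> 2 ^ length \<omega>"
  using assms
proof (induction \<omega>)
  case Nil
  have "real_energy leg \<le> 1"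
    using form_domain_energy_leI(2)[OF continuous_on_leg, of 0 1] by (simp add: bform_leg leg_ends)
  then show ?case using bump_leg by (intro bexI[of _ leg]) (simp_all add: bump_def)
next
  case (Cons i \<omega>)
  then obtain f where f: "f \<in> form_domain" "f q\<^sub>1 = 0" "f (fword \<omega> q\<^sub>2) = 1"
    "real_energy f \<le> 2 ^ length \<omega>" by auto
  have K: "fword \<omega> q\<^sub>2 \<in> K" using Cons.prems root_word_4[of \<omega>] fword_in_K q_in_K by simp
  define h where "h = (if i = 0 then [f, \<lambda>_. 0, \<lambda>_. f q\<^sub>2, \<lambda>_. 0] else [\<lambda>_. 0, f, \<lambda>_. 0, \<lambda>_. f q\<^sub>3])"
  have comp: "compatible ((!) h)" by (simp add: h_def compatible_def f)
  have dom: "h ! j \<in> form_domain" if "j < 4" for j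
    using that f by (auto simp: h_def less_4_cases const_form_domain)
  have i: "i = 0 \<or> i = Suc 0" using Cons.prems by auto
  have "glue ((!) h) q\<^sub>1 = 0"
    using glue_fmap[OF comp, of 0 q\<^sub>1] q_in_K f by (simp add: fmap_q h_def)
  moreover have "glue ((!) h) (fword (i # \<omega>) q\<^sub>2) = 1"
    using glue_fmap[OF comp, of i "fword \<omega> q\<^sub>2"] K f i by (auto simp: h_def)
  moreover have "real_energy (glue ((!) h)) \<le> 2 * real_energy f"
    using glue_form_domain(2)[OF comp dom] by (auto simp: sum_less_4 h_def real_energy_const split: if_splits)
  ultimately show ?case using f(4) glue_form_domain(1)[OF comp dom]
    by (intro bexI[of _ "glue ((!) h)"]) auto
qed

lemma resistance_root_word:
  assumes "set \<omega> \<subseteq> {..<2}"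
  shows "1 / 2 ^ length \<omega> \<le> resistance q\<^sub>1 (fword \<omega> q\<^sub>2)"
  using root_word_test_function[OF assms] resistance_ge fword_in_K[OF root_word_4[OF assms] q_in_K(2)]
  by blast

text \<open>
  A test function keeps only the fraction \<open>1 / 2 ^ length \<omega>\<close> of its energy in the cell of \<open>\<omega>\<close>, whose apex
  is \<open>q\<^sub>1\<close>, and \<open>root_oscillation\<close> applies there. The last letter 2 keeps the points away from \<open>q\<^sub>1\<close>, so that
  the copies of \<open>leg\<close> separate them from it.
\<close>

lemma resistance_root_cell:
  assumes "set \<omega> \<subseteq> {..<2}" "z \<in> K"
  shows "resistance q\<^sub>1 (fword \<omega> (fmap 2 z)) \<le> 9 / 2 ^ length \<omega>"
proof -
  define y where "y = fword \<omega> (fmap 2 z)"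
  have z: "fmap 2 z \<in> K" using assms(2) by (intro fmap_in_K) auto
  define f where "f = (spread ^^ length \<omega>) leg"
  have f: "f \<in> form_domain" "f q\<^sub>1 = 0" using bump_funpow(1) by (simp_all add: f_def bump_def)
  have "f y = leg (fmap 2 z)" unfolding f_def y_def by (rule spread_fword[OF assms(1) z])
  then have fy: "0 < f y" using leg_range(1)[OF assms(2)] by (simp add: leg_fmap[OF assms(2)])
  then have "y \<noteq> q\<^sub>1" using f by auto
  have ne: "test_energies y \<noteq> {}" using test_energies_nonempty[OF f(1)] f(2) fy by simp
  have "2 ^ length \<omega> / 9 \<le> Inf (test_energies y)"
  proof (rule cInf_greatest[OF ne])
    fix e assume "e \<in> test_energies y"
    then obtain u where u: "u \<in> form_domain" "u q\<^sub>1 = 0" "u y = 1" "e = real_energy u"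
      by (auto simp: test_energies_def)
    have g: "u \<circ> fword \<omega> \<in> form_domain" "real_energy (u \<circ> fword \<omega>) \<le> e / 2 ^ length \<omega>"
      using real_energy_fword[OF u(1) root_word_4[OF assms(1)]] u(4) by auto
    have "1 \<le> 9 * real_energy (u \<circ> fword \<omega>)"
      using root_oscillation[OF g(1) z] u fword_root[OF assms(1)] by (simp add: y_def)
    then have "1 \<le> 9 * (e / 2 ^ length \<omega>)" using g(2) by linarith
    then show "2 ^ length \<omega> / 9 \<le> e" by (simp add: field_simps)
  qed
  then have "1 / Inf (test_energies y) \<le> 1 / (2 ^ length \<omega> / 9)"
    by (intro frac_le) auto
  then show ?thesis using \<open>y \<noteq> q\<^sub>1\<close> by (simp add: resistance_root y_def)
qed

text \<open>
  Let \<open>N\<close> be the closed set of points that no function of finite energy separates from \<open>q\<^sub>1\<close>. Off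
  \<open>N\<close> the infimum of the test energies is at least \<open>t\<close> exactly on a closed set \<open>H t\<close>, because that
  condition is a family of inequalities between continuous functions; so the ball is there
  a countable union of closed sets. On \<open>N\<close> the resistance is constant away from \<open>q\<^sub>1\<close>.
\<close>

lemma rball_root_borel:
  assumes "0 < \<rho>"
  shows "rball q\<^sub>1 \<rho> \<in> sets borel"
proof -
  define N where "N = K \<inter> (\<Inter>f\<in>form_domain. {y \<in> K. f y = f q\<^sub>1})"
  define H where "H t = K \<inter> (\<Inter>f\<in>{f \<in> form_domain. f q\<^sub>1 = 0}. {y \<in> K. t * (f y)\<^sup>2 \<le> real_energy f})" for t
  have N: "closed N" unfolding N_def form_domain_def
    by (intro closed_Int closed_K closed_INT ballI continuous_closed_preimage_constant) auto
  have H: "closed (H t)" for t unfolding H_def form_domain_def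
    by (intro closed_Int closed_K closed_INT ballI continuous_on_closed_Collect_le continuous_intros closed_K) auto
  have q1: "q\<^sub>1 \<in> N" using q_in_K by (simp add: N_def)
  have emp: "test_energies y = {}" if "y \<in> N" for y
    using that by (force simp: N_def test_energies_def)
  have separated: "test_energies y \<noteq> {}" if "y \<in> K" "y \<notin> N" for y
    using that test_energies_nonempty[of _ y] by (auto simp: N_def)
  have iff: "t \<le> Inf (test_energies y) \<longleftrightarrow> y \<in> H t" if y: "y \<in> K" "y \<notin> N" and t: "0 < t" for y t
  proof -
    note ne = separated[OF y]
    show ?thesis
    proof
      assume le: "t \<le> Inf (test_energies y)"
      have "t * (g y)\<^sup>2 \<le> real_energy g" if g: "g \<in> form_domain" "g q\<^sub>1 = 0" for g
      proof (cases "g y = 0")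
        case True
        then show ?thesis using real_energy_nonneg[OF g(1)] by simp
      next
        case False
        from test_energies_normalise[OF g False] obtain e where e: "e \<in> test_energies y" "e \<le> real_energy g / (g y)\<^sup>2" ..
        have "t \<le> real_energy g / (g y)\<^sup>2"
          using le cInf_lower[OF e(1) test_energies_bdd[OF y(1)]] e(2) by linarith
        then show ?thesis using False by (simp add: pos_le_divide_eq)
      qed
      then show "y \<in> H t" using y by (simp add: H_def)
    next
      assume "y \<in> H t"
      then show "t \<le> Inf (test_energies y)"
        by (intro cInf_greatest[OF ne]) (force simp: H_def test_energies_def)
    qed
  qed
  have near: "resistance q\<^sub>1 y < \<rho> \<longleftrightarrow> (\<exists>j. y \<in> H (1 / \<rho> + 1 / real (Suc j)))" if y: "y \<in> K" "y \<notin> N" for y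
  proof -
    have pos: "0 < Inf (test_energies y)" by (rule Inf_test_energies_pos[OF y(1) separated[OF y]])
    have "y \<noteq> q\<^sub>1" using y q1 by blast
    then have "resistance q\<^sub>1 y < \<rho> \<longleftrightarrow> 1 / \<rho> < Inf (test_energies y)"
      using pos assms by (simp add: resistance_root field_simps)
    also have "\<dots> \<longleftrightarrow> (\<exists>j. 1 / \<rho> + 1 / real (Suc j) \<le> Inf (test_energies y))"
    proof
      assume "1 / \<rho> < Inf (test_energies y)"
      then obtain j where "inverse (real (Suc j)) < Inf (test_energies y) - 1 / \<rho>"
        using reals_Archimedean[of "Inf (test_energies y) - 1 / \<rho>"] by auto
      then have "1 / \<rho> + 1 / real (Suc j) \<le> Inf (test_energies y)" by (simp add: inverse_eq_divide)
      then show "\<exists>j. 1 / \<rho> + 1 / real (Suc j) \<le> Inf (test_energies y)" ..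
    next
      assume "\<exists>j. 1 / \<rho> + 1 / real (Suc j) \<le> Inf (test_energies y)"
      then obtain j where "1 / \<rho> + 1 / real (Suc j) \<le> Inf (test_energies y)" ..
      moreover have "0 < 1 / real (Suc j)" by simp
      ultimately show "1 / \<rho> < Inf (test_energies y)" by linarith
    qed
    also have "\<dots> \<longleftrightarrow> (\<exists>j. y \<in> H (1 / \<rho> + 1 / real (Suc j)))"
      using assms by (intro ex_cong1 iff y) (simp add: add_pos_pos)
    finally show ?thesis .
  qed
  have far: "resistance q\<^sub>1 y < \<rho> \<longleftrightarrow> y = q\<^sub>1 \<or> 1 / Inf ({} :: real set) < \<rho>" if "y \<in> N" for y
    using emp[OF that] assms by (cases "y = q\<^sub>1") (auto simp: resistance_root resistance_def[of q\<^sub>1 q\<^sub>1])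
  have "N \<subseteq> K" by (auto simp: N_def)
  moreover have "H t \<subseteq> K" for t by (auto simp: H_def)
  ultimately have "rball q\<^sub>1 \<rho> = {q\<^sub>1} \<union> (if 1 / Inf ({} :: real set) < \<rho> then N else {})
      \<union> ((\<Union>j. H (1 / \<rho> + 1 / real (Suc j))) - N)" (is "_ = ?R")
  proof (intro set_eqI)
    fix y
    show "y \<in> rball q\<^sub>1 \<rho> \<longleftrightarrow> y \<in> ?R"
    proof (cases "y \<in> N")
      case True
      then show ?thesis using far[OF True] \<open>N \<subseteq> K\<close> by (auto simp: rball_def)
    next
      case False
      then have "y \<noteq> q\<^sub>1" using q1 by blast
      then show ?thesis using near[of y] False \<open>\<And>t. H t \<subseteq> K\<close> by (auto simp: rball_def)
    qed
  qed
  moreover have "\<dots> \<in> sets borel" using N H by (auto intro!: sets.Un sets.Diff sets.countable_UN)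
  ultimately show ?thesis by simp
qed

section \<open>Masses of cells and essential bounds\<close>

lemma borel_subset_sets:
  assumes "self_similar_measure w \<mu>" "A \<in> sets borel" "A \<subseteq> K"
  shows "A \<in> sets \<mu>"
  using assms by (auto simp: self_similar_measure_def sets_restrict_space intro!: image_eqI[of _ _ A])

lemma compact_cell: "set \<omega> \<subseteq> {..<4} \<Longrightarrow> compact (fword \<omega> ` K)"
proof (induction \<omega>)
  case (Cons i \<omega>)
  then show ?case using compact_continuous_image[OF continuous_on_fmap, of "fword \<omega> ` K" i]
    by (simp add: image_image)
qed (simp add: compact_K)

lemma cell_subset_K: "set \<omega> \<subseteq> {..<4} \<Longrightarrow> fword \<omega> ` K \<subseteq> K"
  using fword_in_K by blast

lemma cell_sets:
  assumes "self_similar_measure w \<mu>" "set \<omega> \<subseteq> {..<4}"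
  shows "fword \<omega> ` K \<in> sets \<mu>"
  using borel_subset_sets[OF assms(1) _ cell_subset_K[OF assms(2)]]
    compact_imp_closed[OF compact_cell[OF assms(2)]] by simp

text \<open>
  One summand of the self-similarity relation for the cell of \<open>i # \<omega>\<close> is at least \<open>w i\<close> times the mass of the cell of
  \<open>\<omega>\<close>.
\<close>

lemma cell_measure_pos:
  assumes w: "\<And>i. i < 4 \<Longrightarrow> 0 < w i" and \<mu>: "self_similar_measure w \<mu>" and "set \<omega> \<subseteq> {..<4}"
  shows "0 < measure \<mu> (fword \<omega> ` K)"
  using assms(3)
proof (induction \<omega>)
  case Nil
  have "space \<mu> = K"
    using \<mu> sets_eq_imp_space_eq[of \<mu> "restrict_space borel K"]
    by (simp add: self_similar_measure_def space_restrict_space)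
  moreover have "prob_space \<mu>" using \<mu> by (simp add: self_similar_measure_def)
  ultimately show ?case using prob_space.prob_space[of \<mu>] by simp
next
  case (Cons i \<omega>)
  interpret prob_space \<mu> using \<mu> by (simp add: self_similar_measure_def)
  have i: "i < 4" and \<omega>: "set \<omega> \<subseteq> {..<4}" using Cons.prems by auto
  define A where "A = fword (i # \<omega>) ` K"
  have A: "A \<in> sets \<mu>" "closed A"
    unfolding A_def using cell_sets[OF \<mu> Cons.prems] compact_cell[OF Cons.prems] compact_imp_closed by blast+
  have "closed (fmap i -` A \<inter> K)"
    using continuous_on_fmap[of K i] A(2) unfolding continuous_on_closed_vimage[OF closed_K] by blast
  then have pre: "fmap i -` A \<inter> K \<in> sets \<mu>" by (intro borel_subset_sets[OF \<mu>]) auto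
  have "0 < w i * measure \<mu> (fword \<omega> ` K)" using w[OF i] Cons.IH[OF \<omega>] by simp
  also have "\<dots> \<le> w i * measure \<mu> (fmap i -` A \<inter> K)"
    using w[OF i] pre cell_subset_K[OF \<omega>] by (intro mult_left_mono finite_measure_mono) (auto simp: A_def)
  also have "\<dots> \<le> (\<Sum>i<4. w i * measure \<mu> (fmap i -` A \<inter> K))"
    using i w by (intro member_le_sum) (auto simp: less_imp_le)
  also have "\<dots> = measure \<mu> A" using \<mu> A(1) by (simp add: self_similar_measure_def)
  finally show ?case by (simp add: A_def)
qed

lemma esssup_on_ge:
  assumes "prob_space \<mu>" "A \<in> sets \<mu>" "P \<in> sets \<mu>" "P \<subseteq> A" "0 < measure \<mu> P"
    and ge: "\<And>x. x \<in> P \<Longrightarrow> a \<le> f x"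
  shows "ereal a \<le> esssup_on \<mu> A f"
proof (rule ccontr)
  assume less: "\<not> ereal a \<le> esssup_on \<mu> A f"
  interpret prob_space \<mu> by fact
  have "AE x in restrict_space \<mu> A. ereal (f x) \<le> esssup_on \<mu> A f"
    unfolding esssup_on_def by (rule esssup_AE)
  then have "AE x in \<mu>. x \<in> A \<longrightarrow> ereal (f x) \<le> esssup_on \<mu> A f"
    using assms(2) by (subst (asm) AE_restrict_space_iff) auto
  then have "AE x in \<mu>. x \<notin> P"
  proof (rule AE_mp, intro AE_I2 impI notI)
    fix x assume "x \<in> A \<longrightarrow> ereal (f x) \<le> esssup_on \<mu> A f" "x \<in> P"
    then have "ereal (f x) \<le> esssup_on \<mu> A f" using assms(4) by blast
    moreover have "ereal a \<le> ereal (f x)" using ge[OF \<open>x \<in> P\<close>] by simp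
    ultimately show False using less order_trans by blast
  qed
  then have "prob P = 0" using prob_eq_0[OF assms(3)] by simp
  then show False using assms(5) by simp
qed

section \<open>Failure of the Harnack inequality\<close>

theorem theorem4p1:
  fixes w :: "nat \<Rightarrow> real" and \<mu> :: "(real \<times> real) measure"
  assumes "\<And>i. i < 4 \<Longrightarrow> 0 < w i \<and> w i < 1"
    and "(\<Sum>i<4. w i) = 1"
    and "w 0 = w 1" and "w 2 = w 3"
    and "self_similar_measure w \<mu>"
  shows "\<not> EHI \<mu>"
proof
  assume "EHI \<mu>"
  then obtain \<epsilon> C :: real where \<epsilon>: "0 < \<epsilon>" "\<epsilon> < 1" and C: "1 \<le> C"
    and harnack: "\<And>x r u. x \<in> K \<Longrightarrow> 0 < r \<Longrightarrow> nonneg_harmonic_in \<mu> (rball x r) u \<Longrightarrow>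
        esssup_on \<mu> (rball x (\<epsilon> * r)) u \<le> ereal C * essinf_on \<mu> (rball x (\<epsilon> * r)) u"
    unfolding EHI_def by metis
  note \<mu> = assms(5)
  have prob: "prob_space \<mu>" using \<mu> by (simp add: self_similar_measure_def)
  have w: "0 < w i" if "i < 4" for i using assms(1) that by blast
  \<comment> \<open>Cells that are \<open>k\<close> levels below the radius of the ball fit into its \<open>\<epsilon>\<close>-part, for every
    radius. Since \<open>k\<close> depends on \<open>\<epsilon>\<close> only, the number of legs can be chosen afterwards.\<close>
  obtain k where k: "9 / 2 ^ k < \<epsilon>"
    using real_arch_pow_inv[of "\<epsilon> / 9" "1 / 2"] \<epsilon> by (auto simp: field_simps)
  obtain m where m: "1 + C * 2 ^ (k + 1) < 2 ^ m"
    using real_arch_pow[of 2 "1 + C * 2 ^ (k + 1)"] by auto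
  define n where "n = Suc m"
  define r :: real where "r = 1 / 2 ^ n"
  have r: "0 < r" by (simp add: r_def)
  have "nonneg_harmonic_in \<mu> (rball q\<^sub>1 r) (steep n)"
    unfolding nonneg_harmonic_in_def harmonic_in_def
  proof (intro conjI ballI steep_form_domain)
    fix \<phi> assume \<phi>: "\<phi> \<in> form_domain_on \<mu> (rball q\<^sub>1 r)"
    have "bform l (steep n) \<phi> = 0" if "l \<ge> n" for l
    proof (rule bform_zero_completion[OF steep_form_domain \<phi>])
      fix \<psi> assume "\<psi> \<in> form_domain" and supp: "supp \<psi> \<subseteq> rball q\<^sub>1 r"
      have vanish: "\<psi> (fword \<omega> q\<^sub>2) = 0" if "length \<omega> = n" "set \<omega> \<subseteq> {..<2}" for \<omega>
      proof (rule ccontr)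
        assume "\<psi> (fword \<omega> q\<^sub>2) \<noteq> 0"
        then have "fword \<omega> q\<^sub>2 \<in> supp \<psi>"
          using fword_in_K[OF root_word_4[OF that(2)] q_in_K(2)] closure_subset
          unfolding supp_def by fastforce
        then have "resistance q\<^sub>1 (fword \<omega> q\<^sub>2) < r" using supp by (auto simp: rball_def)
        then show False using resistance_root_word[OF that(2)] that(1) by (simp add: r_def)
      qed
      have "bform (n + (l - n)) (steep n) \<psi> = 0" by (rule bform_steep) (use vanish in blast)
      then show "bform l (steep n) \<psi> = 0" using that by simp
    qed
    moreover have "\<phi> \<in> form_domain" using \<phi> by (simp add: form_domain_on_def)
    ultimately show "form (steep n) \<phi> = 0" by (intro form_eq_0[OF steep_form_domain])
  next
    fix x assume "x \<in> rball q\<^sub>1 r"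
    then show "0 \<le> steep n x" by (intro steep_nonneg) (simp add: rball_def)
  qed
  note ineq = harnack[OF q_in_K(1) r this]
  define B where "B = rball q\<^sub>1 (\<epsilon> * r)"
  have B: "B \<in> sets \<mu>"
    unfolding B_def using \<epsilon> r by (intro borel_subset_sets[OF \<mu>] rball_root_borel) (auto simp: rball_def)
  have cell: "fword (\<omega> @ [2]) ` K \<subseteq> B" if "set \<omega> \<subseteq> {..<2}" "length \<omega> = n + k" for \<omega>
  proof
    fix y assume "y \<in> fword (\<omega> @ [2]) ` K"
    then obtain z where z: "z \<in> K" "y = fword \<omega> (fmap 2 z)" by (auto simp: fword_append)
    have "resistance q\<^sub>1 y \<le> 9 / 2 ^ (n + k)"
      using resistance_root_cell[OF that(1) z(1)] that(2) z(2) by simp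
    also have "\<dots> = 9 / 2 ^ k * r" by (simp add: r_def power_add)
    also have "\<dots> < \<epsilon> * r" by (rule mult_strict_right_mono[OF k r])
    finally have "resistance q\<^sub>1 y < \<epsilon> * r" .
    moreover have "y \<in> K" using z fword_in_K[OF root_word_4[OF that(1)] fmap_in_K[of 2 z]] by simp
    ultimately show "y \<in> B" by (simp add: B_def rball_def)
  qed
  \<comment> \<open>The first cell lies on the steep leg, at height at least \<open>1 / 2 ^ (k + 1)\<close> because of the final
    letter 2; the second lies in a cell whose first letter 1 excludes the steep leg.\<close>
  define \<omega>\<^sub>1 \<omega>\<^sub>2 :: "nat list" where "\<omega>\<^sub>1 = replicate (n + k) 0" and "\<omega>\<^sub>2 = Suc 0 # replicate (m + k) 0"
  have words: "set \<omega>\<^sub>1 \<subseteq> {..<2}" "length \<omega>\<^sub>1 = n + k" "set \<omega>\<^sub>2 \<subseteq> {..<2}" "length \<omega>\<^sub>2 = n + k"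
    by (auto simp: \<omega>\<^sub>1_def \<omega>\<^sub>2_def n_def)
  have words4: "set (\<omega>\<^sub>1 @ [2]) \<subseteq> {..<4}" "set (\<omega>\<^sub>2 @ [2]) \<subseteq> {..<4}"
    using root_word_4[OF words(1)] root_word_4[OF words(3)] by auto
  define a :: real where "a = 1 + (2 ^ n - 1) / 2 ^ (k + 1)"
  have high: "a \<le> steep n y" if y: "y \<in> fword (\<omega>\<^sub>1 @ [2]) ` K" for y
  proof -
    obtain z where z: "z \<in> K" "y = fword \<omega>\<^sub>1 (fmap 2 z)" using y by (auto simp: fword_append)
    define x where "x = fword (replicate k 0) (fmap 2 z)"
    have 2: "fmap 2 z \<in> K" using z(1) by (intro fmap_in_K) auto
    have x: "x \<in> K" unfolding x_def by (intro fword_in_K 2) auto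
    have "leg x = (1 / 2 + leg z / 2) / 2 ^ k"
      unfolding x_def leg_fword_0[OF 2] leg_fmap(3)[OF z(1)] ..
    then have lx: "1 / 2 ^ (k + 1) \<le> leg x"
      using leg_range(1)[OF z(1)] by (simp add: field_simps)
    have "y = fword (replicate n 0) x"
      by (simp add: z x_def \<omega>\<^sub>1_def replicate_add fword_append)
    then have "steep n y = 1 + (2 ^ n - 1) * leg x" using steep_on_leg[OF x] by simp
    moreover have "(2 ^ n - 1) * (1 / 2 ^ (k + 1)) \<le> (2 ^ n - 1) * leg x"
      by (rule mult_left_mono[OF lx]) simp
    ultimately show ?thesis by (simp add: a_def)
  qed
  have low: "- 1 \<le> - steep n y" if y: "y \<in> fword (\<omega>\<^sub>2 @ [2]) ` K" for y
  proof -
    obtain z where z: "z \<in> K" "y = fmap (Suc 0) (fword (replicate (m + k) 0) (fmap 2 z))"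
      using y by (auto simp: fword_append \<omega>\<^sub>2_def)
    have "fword (replicate (m + k) 0) (fmap 2 z) \<in> K" using z(1) by (intro fword_in_K fmap_in_K) auto
    from steep_off_leg[OF this, of m] show ?thesis by (simp add: z n_def)
  qed
  have "ereal a \<le> esssup_on \<mu> B (steep n)"
    by (rule esssup_on_ge[OF prob B cell_sets[OF \<mu> words4(1)] cell[OF words(1,2)]
          cell_measure_pos[OF w \<mu> words4(1)] high])
  also have "\<dots> \<le> ereal C * essinf_on \<mu> B (steep n)" using ineq by (simp add: B_def)
  also have "\<dots> \<le> ereal C * 1"
  proof (rule ereal_mult_left_mono)
    have "ereal (- 1) \<le> esssup_on \<mu> B (\<lambda>x. - steep n x)"
      by (rule esssup_on_ge[OF prob B cell_sets[OF \<mu> words4(2)] cell[OF words(3,4)]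
            cell_measure_pos[OF w \<mu> words4(2)] low])
    then show "essinf_on \<mu> B (steep n) \<le> 1"
      unfolding essinf_on_def by (simp add: ereal_uminus_le_reorder one_ereal_def)
  qed (use C in simp)
  finally have "a \<le> C" by simp
  have "C * 2 ^ (k + 1) < 2 ^ n - 1"
  proof -
    have "(2::real) ^ m \<le> 2 ^ n" by (simp add: n_def)
    then show ?thesis using m by linarith
  qed
  then have "C < (2 ^ n - 1) / 2 ^ (k + 1)" by (simp add: pos_less_divide_eq)
  then show False using \<open>a \<le> C\<close> by (simp add: a_def)
qed

end
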